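(* Let $d\geq 2$ and let $\mathbb{S}^{d-1}$ be the $(d-1)$-dimensional Euclidean sphere equipped with a rotation-invariant metric $D$ which is compatible with the usual topology of $\mathbb{S}^{d-1}$. Then the Lipschitz-free space $\mathcal{F}(\mathbb{S}^{d-1},D)$ has the metric approximation property.
   Context: $\mathbb{S}^{d-1}$ is the unit sphere of $\mathbb{R}^d$. The metric $D$ is rotation-invariant if $D(Rx,Ry)=D(x,y)$ for all rotations $R$ of $\mathbb{R}^d$ about the origin and all $x,y\in\mathbb{S}^{d-1}$; it is compatible with the usual topology if it induces that topology. $D$ is not assumed to be a quotient of a metric on $O(d)$. For a metric space $M$ with a distinguished point $0\in M$, $\mathrm{Lip}_0(M)$ is the Banach space of real-valued Lipschitz functions on $M$ vanishing at $0$, normed by the minimal Lipschitz constant. The Lipschitz-free space $\mathcal{F}(M)$ is the closed linear span of $\{\delta(x):x\in M\}$ in $\mathrm{Lip}_0(M)^*$, where $\delta(x)(f)=f(x)$ (up to linear isometry it does not depend on the choice of $0$). A Banach space $X$ has the metric approximation property (MAP) if for each compact subset $K$ of $X$ and each $\epsilon>0$ there is a finite rank operator $T$ on $X$ with $\|T\|\le 1$ such that $\|Tx-x\|<\epsilon$ for each $x\in K$. *)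

theory Defs
  imports "HOL-Analysis.Analysis" "HOL-Library.Function_Algebras"
begin

text \<open>
  The space \<open>Lip\<^sub>0\<close>, its dual and the Lipschitz-free space depend on the metric, which
  is a variable, so they cannot be types. They are linear subspaces of function types,
  which carry the pointwise vector space structure; a function defined on a set is
  represented by its extension by \<open>0\<close>.
\<close>

instantiation "fun" :: (type, scaleR) scaleR
begin
definition "scaleR c f = (\<lambda>x. scaleR c (f x))"
instance ..
end

lemma scaleR_fun_apply [simp]: "(c *\<^sub>R f) x = c *\<^sub>R f x"
  by (simp add: scaleR_fun_def)

instance "fun" :: (type, real_vector) real_vector
  by standard (simp_all add: fun_eq_iff scaleR_add_right scaleR_add_left)


subsection \<open>Normed spaces given by a linear subspace \<open>X\<close> and a norm \<open>N\<close> on it\<close>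

text \<open>The distance is \<open>0\<close> off \<open>X\<close> because \<open>Metric_space\<close> constrains it there as well.\<close>

definition norm_dist :: "'v::real_vector set \<Rightarrow> ('v \<Rightarrow> real) \<Rightarrow> 'v \<Rightarrow> 'v \<Rightarrow> real" where
  "norm_dist X N x y = (if x \<in> X \<and> y \<in> X then N (x - y) else 0)"

definition norm_topology :: "'v::real_vector set \<Rightarrow> ('v \<Rightarrow> real) \<Rightarrow> 'v topology" where
  "norm_topology X N = Metric_space.mtopology X (norm_dist X N)"

definition bounded_linear_on ::
  "'v::real_vector set \<Rightarrow> ('v \<Rightarrow> real) \<Rightarrow> 'w::real_vector set \<Rightarrow> ('w \<Rightarrow> real) \<Rightarrow> ('v \<Rightarrow> 'w) \<Rightarrow> bool" where
  "bounded_linear_on X N Y N' T \<longleftrightarrow>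
     T \<in> X \<rightarrow> Y \<and>
     (\<forall>x\<in>X. \<forall>y\<in>X. T (x + y) = T x + T y) \<and>
     (\<forall>c. \<forall>x\<in>X. T (c *\<^sub>R x) = c *\<^sub>R T x) \<and>
     (\<exists>B. \<forall>x\<in>X. N' (T x) \<le> B * N x)"

definition op_norm :: "'v set \<Rightarrow> ('v \<Rightarrow> real) \<Rightarrow> ('w \<Rightarrow> real) \<Rightarrow> ('v \<Rightarrow> 'w) \<Rightarrow> real" where
  "op_norm X N N' T = Inf {B. 0 \<le> B \<and> (\<forall>x\<in>X. N' (T x) \<le> B * N x)}"

definition dual_space :: "'v::real_vector set \<Rightarrow> ('v \<Rightarrow> real) \<Rightarrow> ('v \<Rightarrow> real) set" where
  "dual_space X N =
     {\<phi>. bounded_linear_on X N (UNIV :: real set) norm \<phi> \<and> (\<forall>x. x \<notin> X \<longrightarrow> \<phi> x = 0)}"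

definition dual_norm :: "'v set \<Rightarrow> ('v \<Rightarrow> real) \<Rightarrow> ('v \<Rightarrow> real) \<Rightarrow> real" where
  "dual_norm X N = op_norm X N norm"

definition finite_rank_on :: "'v set \<Rightarrow> ('v \<Rightarrow> 'w::real_vector) \<Rightarrow> bool" where
  "finite_rank_on X T \<longleftrightarrow> (\<exists>B. finite B \<and> T ` X \<subseteq> span B)"

definition metric_approximation_property :: "'v::real_vector set \<Rightarrow> ('v \<Rightarrow> real) \<Rightarrow> bool" where
  "metric_approximation_property X N \<longleftrightarrow>
     (\<forall>K \<epsilon>. compactin (norm_topology X N) K \<and> \<epsilon> > 0 \<longrightarrow>
        (\<exists>T. bounded_linear_on X N X N T \<and> finite_rank_on X T \<and> op_norm X N N T \<le> 1 \<and>
             (\<forall>x\<in>K. N (T x - x) < \<epsilon>)))"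


subsection \<open>Lipschitz-free spaces\<close>

definition Lip0 :: "'a metric \<Rightarrow> 'a \<Rightarrow> ('a \<Rightarrow> real) set" where
  "Lip0 M z =
     {f. Lipschitz_continuous_map M euclidean_metric f \<and> f z = 0 \<and> (\<forall>x. x \<notin> mspace M \<longrightarrow> f x = 0)}"

definition lip_norm :: "'a metric \<Rightarrow> ('a \<Rightarrow> real) \<Rightarrow> real" where
  "lip_norm M f =
     Inf {L. 0 \<le> L \<and> (\<forall>x\<in>mspace M. \<forall>y\<in>mspace M. \<bar>f x - f y\<bar> \<le> L * mdist M x y)}"

definition evaluation :: "'a metric \<Rightarrow> 'a \<Rightarrow> 'a \<Rightarrow> ('a \<Rightarrow> real) \<Rightarrow> real" where
  "evaluation M z x = (\<lambda>f. if f \<in> Lip0 M z then f x else 0)"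

abbreviation Lip0_dual :: "'a metric \<Rightarrow> 'a \<Rightarrow> (('a \<Rightarrow> real) \<Rightarrow> real) set" where
  "Lip0_dual M z \<equiv> dual_space (Lip0 M z) (lip_norm M)"

abbreviation Lip0_dual_norm :: "'a metric \<Rightarrow> 'a \<Rightarrow> (('a \<Rightarrow> real) \<Rightarrow> real) \<Rightarrow> real" where
  "Lip0_dual_norm M z \<equiv> dual_norm (Lip0 M z) (lip_norm M)"

definition lipschitz_free_space :: "'a metric \<Rightarrow> 'a \<Rightarrow> (('a \<Rightarrow> real) \<Rightarrow> real) set" where
  "lipschitz_free_space M z =
     norm_topology (Lip0_dual M z) (Lip0_dual_norm M z) closure_of span (evaluation M z ` mspace M)"

end

theory Submission
  imports Defs
begin

text \<open>
  Let \<open>\<Lambda>\<close> be the Haar mean on \<open>SO(d)\<close>, weighted by a nonnegative polynomial in the matrix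
  entries that is concentrated near the identity. Averaging \<open>f\<close> over \<open>\<Lambda>\<close> along the orbits of the
  action, and subtracting the value at the base point, is a contraction of \<open>Lip\<^sub>0\<close> because the
  rotations are isometries, and it moves functions of norm at most \<open>1\<close> uniformly little. By
  invariance of the Haar mean, all averages lie in the finite-dimensional space spanned by the
  translates of the polynomial. The adjoint of this operator preserves the Lipschitz-free space, as
  \<open>\<Lambda>\<close> is a limit of finite combinations of point evaluations.
\<close>


subsection \<open>Means on compact sets\<close>

text \<open>The approximants must be contractions for \<open>D\<close> itself, and \<open>D\<close>
  need not be comparable with the Euclidean metric, so an estimate up to a constant would be
  useless; averaging over isometries costs no constant. What has to be arranged is finite rank, and
  this is why the weight is a polynomial and not an arbitrary bump function: a point of the sphere
  is written as the image of the base point under a rotation, right invariance moves the dependence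
  on the point from \<open>f\<close> to the weight, and a polynomial of a product of two matrices
  separates into finitely many terms. One weight serves all points at once because the displacement
  of a point under a rotation is uniformly continuous on the compact product of group and sphere.

  Only the integral of continuous functions is required of Haar measure. It is built from left
  translations, which commute with right translations; this is the source of its right
  invariance.\<close>

locale mean_functional =
  fixes G :: "'a::metric_space set" and \<Lambda> :: "('a \<Rightarrow> real) \<Rightarrow> real"
  assumes add: "\<lbrakk>continuous_on G u; continuous_on G v\<rbrakk> \<Longrightarrow> \<Lambda> (\<lambda>g. u g + v g) = \<Lambda> u + \<Lambda> v"
    and scale: "continuous_on G u \<Longrightarrow> \<Lambda> (\<lambda>g. c * u g) = c * \<Lambda> u"
    and mono: "\<lbrakk>continuous_on G u; continuous_on G v; \<And>g. g \<in> G \<Longrightarrow> u g \<le> v g\<rbrakk> \<Longrightarrow> \<Lambda> u \<le> \<Lambda> v"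
    and one: "\<Lambda> (\<lambda>_. 1) = 1"
begin

lemma cong:
  assumes "continuous_on G u" "\<And>g. g \<in> G \<Longrightarrow> u g = v g"
  shows "\<Lambda> u = \<Lambda> v"
proof -
  have "continuous_on G v"
    using assms by (metis (no_types, lifting) continuous_on_cong)
  then show ?thesis
    using assms by (intro antisym mono) auto
qed

lemma const [simp]: "\<Lambda> (\<lambda>_. c) = c"
  using scale[of "\<lambda>_. 1" c] one by simp

lemma diff:
  assumes "continuous_on G u" "continuous_on G v"
  shows "\<Lambda> (\<lambda>g. u g - v g) = \<Lambda> u - \<Lambda> v"
  using add[of u "\<lambda>g. - 1 * v g"] scale[of v "-1"] assms by (simp add: continuous_on_minus)

lemma sum:
  assumes "finite I" "\<And>i. i \<in> I \<Longrightarrow> continuous_on G (u i)"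
  shows "\<Lambda> (\<lambda>g. \<Sum>i\<in>I. u i g) = (\<Sum>i\<in>I. \<Lambda> (u i))"
  using assms by (induction I) (auto simp: add continuous_on_sum)

lemma abs_le:
  assumes "continuous_on G u" "continuous_on G v" "\<And>g. g \<in> G \<Longrightarrow> \<bar>u g\<bar> \<le> v g"
  shows "\<bar>\<Lambda> u\<bar> \<le> \<Lambda> v"
proof -
  have "\<Lambda> u \<le> \<Lambda> v" "\<Lambda> (\<lambda>g. - 1 * u g) \<le> \<Lambda> v"
    using assms by (intro mono continuous_intros; force)+
  then show ?thesis
    using scale[OF assms(1), of "-1"] by simp
qed

lemma weighted:
  assumes "continuous_on G p" "\<And>g. g \<in> G \<Longrightarrow> 0 \<le> p g" "0 < \<Lambda> p"
  shows "mean_functional G (\<lambda>u. \<Lambda> (\<lambda>g. p g * u g) / \<Lambda> p)"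
proof
  fix u v :: "'a \<Rightarrow> real" and c assume u: "continuous_on G u"
  show "\<Lambda> (\<lambda>g. p g * (c * u g)) / \<Lambda> p = c * (\<Lambda> (\<lambda>g. p g * u g) / \<Lambda> p)"
    using scale[of "\<lambda>g. p g * u g" c] u assms by (simp add: continuous_on_mult mult_ac)
  assume v: "continuous_on G v"
  show "\<Lambda> (\<lambda>g. p g * (u g + v g)) / \<Lambda> p
          = \<Lambda> (\<lambda>g. p g * u g) / \<Lambda> p + \<Lambda> (\<lambda>g. p g * v g) / \<Lambda> p"
    using add[of "\<lambda>g. p g * u g" "\<lambda>g. p g * v g"] u v assms
    by (simp add: continuous_on_mult distrib_left add_divide_distrib)
  assume "\<And>g. g \<in> G \<Longrightarrow> u g \<le> v g"
  then show "\<Lambda> (\<lambda>g. p g * u g) / \<Lambda> p \<le> \<Lambda> (\<lambda>g. p g * v g) / \<Lambda> p"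
    using u v assms by (intro divide_right_mono mono) (auto intro!: continuous_intros mult_left_mono)
qed (use assms in auto)

text \<open>A partition of unity subordinate to a cover by small balls turns the mean into a finite
  combination of point evaluations.\<close>

lemma finite_approx:
  fixes w :: "'a \<Rightarrow> 'a \<Rightarrow> real"
  assumes "compact G" "\<And>g. g \<in> G \<Longrightarrow> continuous_on G (w g)" "\<And>g. g \<in> G \<Longrightarrow> w g g = 0" "0 < \<eta>"
  obtains I c where "finite I" "I \<subseteq> G"
    "\<And>u C. \<lbrakk>continuous_on G u; 0 \<le> C; \<And>g h. \<lbrakk>g \<in> G; h \<in> G\<rbrakk> \<Longrightarrow> \<bar>u g - u h\<bar> \<le> C * w g h\<rbrakk>
        \<Longrightarrow> \<bar>\<Lambda> u - (\<Sum>i\<in>I. c i * u i)\<bar> \<le> C * \<eta>"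
proof -
  have "\<exists>d>0. \<forall>h\<in>G. dist h g < d \<longrightarrow> w g h < \<eta>" if "g \<in> G" for g
  proof -
    have "\<exists>d>0. \<forall>h\<in>G. dist h g < d \<longrightarrow> dist (w g h) (w g g) < \<eta>"
      using assms(2)[OF that] that \<open>0 < \<eta>\<close> unfolding continuous_on_iff by blast
    then show ?thesis
      using assms(3)[OF that] by (fastforce simp: dist_real_def)
  qed
  then obtain d where d: "\<And>g. g \<in> G \<Longrightarrow> 0 < d g"
      "\<And>g h. \<lbrakk>g \<in> G; h \<in> G; dist h g < d g\<rbrakk> \<Longrightarrow> w g h < \<eta>"
    by metis
  have "G \<subseteq> (\<Union>g\<in>G. ball g (d g))"
    using d(1) by force
  then obtain I where I: "I \<subseteq> G" "finite I" "G \<subseteq> (\<Union>g\<in>I. ball g (d g))"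
    using compactE_image[OF \<open>compact G\<close>, of G "\<lambda>g. ball g (d g)"] by auto
  define \<beta> where "\<beta> i h = max 0 (d i - dist h i)" for i h
  define s where "s h = (\<Sum>i\<in>I. \<beta> i h)" for h
  have s: "0 < s h" if h: "h \<in> G" for h
  proof -
    obtain i where i: "i \<in> I" "dist i h < d i"
      using subsetD[OF I(3) h] by auto
    then have "0 < \<beta> i h"
      by (simp add: \<beta>_def dist_commute)
    then show ?thesis
      unfolding s_def using I(2) i(1) by (intro sum_pos2[where i=i]) (auto simp: \<beta>_def)
  qed
  have cont_\<beta>: "continuous_on G (\<beta> i)" for i
    unfolding \<beta>_def by (intro continuous_intros)
  have cont_s: "continuous_on G s"
    unfolding s_def using cont_\<beta> by (intro continuous_intros) auto
  define \<psi> where "\<psi> i h = \<beta> i h / s h" for i h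
  have cont_\<psi>: "continuous_on G (\<psi> i)" for i
    unfolding \<psi>_def using s by (intro continuous_on_divide cont_\<beta> cont_s) force
  have sum_\<psi>: "(\<Sum>i\<in>I. \<psi> i h) = 1" if "h \<in> G" for h
    using s[OF that] by (simp add: \<psi>_def s_def flip: sum_divide_distrib)
  have \<psi>_ge: "0 \<le> \<psi> i h" if "h \<in> G" for i h
    using s[OF that] by (simp add: \<psi>_def \<beta>_def)
  show thesis
  proof
    \<comment> \<open>The nodes and the weights \<open>\<Lambda> (\<psi> i)\<close> are fixed before
      \<open>u\<close> and depend only on \<open>w\<close>, so the same combination serves every
      \<open>u\<close> whose increments are controlled by \<open>w\<close>. This uniformity is what
      later yields approximation in the dual norm.\<close>
    fix u :: "'a \<Rightarrow> real" and C assume u: "continuous_on G u" and C: "0 \<le> C" and uw: "\<And>g h. \<lbrakk>g \<in> G; h \<in> G\<rbrakk> \<Longrightarrow> \<bar>u g - u h\<bar> \<le> C * w g h"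
    have "(\<Sum>i\<in>I. \<Lambda> (\<psi> i) * u i) = \<Lambda> (\<lambda>h. \<Sum>i\<in>I. u i * \<psi> i h)"
      using cont_\<psi> I(2) by (subst sum) (auto intro!: continuous_intros sum.cong simp: scale mult.commute)
    then have "\<Lambda> u - (\<Sum>i\<in>I. \<Lambda> (\<psi> i) * u i) = \<Lambda> (\<lambda>h. u h - (\<Sum>i\<in>I. u i * \<psi> i h))"
      using u cont_\<psi> by (subst diff) (auto intro!: continuous_intros)
    also have "\<bar>\<dots>\<bar> \<le> \<Lambda> (\<lambda>_. C * \<eta>)"
    proof (rule abs_le)
      show "continuous_on G (\<lambda>h. u h - (\<Sum>i\<in>I. u i * \<psi> i h))"
        using u cont_\<psi> by (auto intro!: continuous_intros)
      fix h assume h: "h \<in> G"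
      have "u h - (\<Sum>i\<in>I. u i * \<psi> i h) = (\<Sum>i\<in>I. \<psi> i h * (u h - u i))"
        using sum_\<psi>[OF h] by (simp add: algebra_simps sum_subtractf flip: sum_distrib_left)
      also have "\<bar>\<dots>\<bar> \<le> (\<Sum>i\<in>I. \<psi> i h * (C * \<eta>))"
      proof (rule order_trans[OF sum_abs sum_mono])
        fix i assume i: "i \<in> I"
        show "\<bar>\<psi> i h * (u h - u i)\<bar> \<le> \<psi> i h * (C * \<eta>)"
        proof (cases "dist h i < d i")
          case True
          then have "w i h \<le> \<eta>"
            using d(2)[of i h] h i I(1) by force
          then have "\<bar>u h - u i\<bar> \<le> C * \<eta>"
            using uw[of i h] h i I(1) mult_left_mono[OF _ C] by (fastforce simp: abs_minus_commute)
          then show ?thesis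
            using \<psi>_ge[OF h] by (simp add: abs_mult mult_left_mono)
        next
          case False
          then show ?thesis
            by (simp add: \<psi>_def \<beta>_def)
        qed
      qed
      also have "\<dots> = C * \<eta>"
        using sum_\<psi>[OF h] by (simp flip: sum_distrib_right)
      finally show "\<bar>u h - (\<Sum>i\<in>I. u i * \<psi> i h)\<bar> \<le> C * \<eta>" .
    qed auto
    finally show "\<bar>\<Lambda> u - (\<Sum>i\<in>I. \<Lambda> (\<psi> i) * u i)\<bar> \<le> C * \<eta>"
      by simp
  qed (use I in auto)
qed

end


subsection \<open>The invariant mean of a compact group\<close>

lemma summable_halves:
  fixes a :: "nat \<Rightarrow> real"
  assumes "\<And>k. \<bar>a k\<bar> \<le> B"
  shows "summable (\<lambda>k. (1/2)^Suc k * a k)"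
proof (rule summable_comparison_test')
  show "summable (\<lambda>k. (1/2)^Suc k * B)"
    by (intro summable_mult2) simp
  show "norm ((1/2)^Suc k * a k) \<le> (1/2)^Suc k * B" if "k \<ge> 0" for k
    using assms[of k] by (simp add: abs_mult)
qed

lemma suminf_halves_const: "(\<Sum>k. (1/2)^Suc k * B) = (B::real)"
  using suminf_mult2[of "\<lambda>k. (1/2::real)^Suc k" B] power_half_series
  by (simp add: sums_iff)

text \<open>The weights sum to 1 and all deficits \<open>r - a k\<close> are nonnegative, so their
  weighted sum is at least its single term with index \<open>j\<close>.\<close>

lemma suminf_halves_le:
  fixes a :: "nat \<Rightarrow> real"
  assumes "\<And>k. \<bar>a k\<bar> \<le> B" "\<And>k. a k \<le> r"
  shows "(\<Sum>k. (1/2)^Suc k * a k) \<le> r - (1/2)^Suc j * (r - a j)"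
proof -
  have s: "summable (\<lambda>k. (1/2)^Suc k * (r - a k))"
  proof (rule summable_halves)
    show "\<bar>r - a k\<bar> \<le> \<bar>r\<bar> + B" for k
      using assms(1)[of k] by linarith
  qed
  have "(1/2)^Suc j * (r - a j) = (\<Sum>k\<in>{j}. (1/2)^Suc k * (r - a k))"
    by simp
  also have "\<dots> \<le> (\<Sum>k. (1/2)^Suc k * (r - a k))"
    using s assms(2) by (intro sum_le_suminf) auto
  also have "\<dots> = (\<Sum>k. (1/2)^Suc k * r) - (\<Sum>k. (1/2)^Suc k * a k)"
    unfolding right_diff_distrib
    by (rule suminf_diff[symmetric]; rule summable_halves[of _ "max \<bar>r\<bar> B"]) (use assms(1) in \<open>auto simp: le_max_iff_disj\<close>)
  finally show ?thesis
    by (simp only: suminf_halves_const)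
qed

text \<open>The group is a carrier set with operations as parameters because the rotations form a
  subset of the matrix type. Second countability supplies the dense sequence of translations from
  which the mean is built.\<close>

locale compact_group =
  fixes G :: "'a::{metric_space,second_countable_topology} set"
    and mul :: "'a \<Rightarrow> 'a \<Rightarrow> 'a" (infixl "\<cdot>" 70) and e :: 'a and iv :: "'a \<Rightarrow> 'a"
  assumes compact: "compact G"
    and mul_closed: "\<lbrakk>g \<in> G; h \<in> G\<rbrakk> \<Longrightarrow> g \<cdot> h \<in> G"
    and unit_closed: "e \<in> G"
    and iv_closed: "g \<in> G \<Longrightarrow> iv g \<in> G"
    and assoc: "\<lbrakk>g \<in> G; h \<in> G; k \<in> G\<rbrakk> \<Longrightarrow> g \<cdot> h \<cdot> k = g \<cdot> (h \<cdot> k)"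
    and left_unit: "g \<in> G \<Longrightarrow> e \<cdot> g = g"
    and right_unit: "g \<in> G \<Longrightarrow> g \<cdot> e = g"
    and left_iv: "g \<in> G \<Longrightarrow> iv g \<cdot> g = e"
    and continuous_mul: "continuous_on (G \<times> G) (\<lambda>(g, h). g \<cdot> h)"
begin

definition dense_seq :: "nat \<Rightarrow> 'a" where
  "dense_seq = (SOME s. range s \<subseteq> G \<and> G \<subseteq> closure (range s))"

lemma dense_seq: "dense_seq k \<in> G" "G \<subseteq> closure (range dense_seq)"
proof -
  obtain T where T: "countable T" "T \<subseteq> G" "G \<subseteq> closure T"
    using separable by blast
  then have "T \<noteq> {}"
    using unit_closed by auto
  then have "range (from_nat_into T) \<subseteq> G \<and> G \<subseteq> closure (range (from_nat_into T))"
    using T by (simp add: range_from_nat_into)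
  then have "range dense_seq \<subseteq> G \<and> G \<subseteq> closure (range dense_seq)"
    unfolding dense_seq_def by (rule someI[where P="\<lambda>s. range s \<subseteq> G \<and> G \<subseteq> closure (range s)"])
  then show "dense_seq k \<in> G" "G \<subseteq> closure (range dense_seq)"
    by auto
qed

text \<open>The invariant mean of \<open>u\<close> is the limit of the iterated random translates of \<open>u\<close>: since the
  translations are dense, the oscillation of the iterates decays to \<open>0\<close>.\<close>

definition avg :: "('a \<Rightarrow> real) \<Rightarrow> 'a \<Rightarrow> real" where
  "avg u g = (\<Sum>k. (1/2)^Suc k * u (dense_seq k \<cdot> g))"

text \<open>Equicontinuity of all left translates of \<open>u\<close>. Since \<open>avg u\<close> is
  a mixture of left translates, the property passes to every iterate with the same
  \<open>\<delta>\<close> and \<open>\<eta>\<close>; the non-strict bound survives infinite convex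
  combinations.\<close>

definition modulus :: "('a \<Rightarrow> real) \<Rightarrow> real \<Rightarrow> real \<Rightarrow> bool" where
  "modulus u \<delta> \<eta> \<longleftrightarrow> (\<forall>t\<in>G. \<forall>g\<in>G. \<forall>h\<in>G. dist g h < \<delta> \<longrightarrow> \<bar>u (t \<cdot> g) - u (t \<cdot> h)\<bar> \<le> \<eta>)"

lemma bounded_translates:
  fixes u :: "'a \<Rightarrow> real"
  assumes "continuous_on G u"
  obtains B where "\<And>g k. g \<in> G \<Longrightarrow> \<bar>u (dense_seq k \<cdot> g)\<bar> \<le> B"
proof -
  have "bounded (u ` G)"
    using assms compact by (intro compact_imp_bounded compact_continuous_image)
  then obtain B where "\<And>g. g \<in> G \<Longrightarrow> \<bar>u g\<bar> \<le> B"
    unfolding bounded_iff by auto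
  then show thesis
    using mul_closed[OF dense_seq(1)] that by blast
qed

section \<open>Elementary properties of the averaging operator\<close>

lemma avg_cong: "\<lbrakk>\<And>g. g \<in> G \<Longrightarrow> u g = v g; g \<in> G\<rbrakk> \<Longrightarrow> avg u g = avg v g"
  unfolding avg_def using mul_closed dense_seq(1) by simp

lemma summable_avg:
  fixes u :: "'a \<Rightarrow> real"
  assumes "continuous_on G u" "g \<in> G"
  shows "summable (\<lambda>k. (1/2)^Suc k * u (dense_seq k \<cdot> g))"
proof -
  obtain B where "\<And>g k. g \<in> G \<Longrightarrow> \<bar>u (dense_seq k \<cdot> g)\<bar> \<le> B"
    using bounded_translates[OF assms(1)] by blast
  then show ?thesis
    using assms(2) by (intro summable_halves) auto
qed

lemma avg_add:
  "\<lbrakk>continuous_on G u; continuous_on G v; g \<in> G\<rbrakk> \<Longrightarrow> avg (\<lambda>g. u g + v g) g = avg u g + avg v g"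
  unfolding avg_def distrib_left by (intro suminf_add[symmetric] summable_avg)

lemma avg_scale: "\<lbrakk>continuous_on G u; g \<in> G\<rbrakk> \<Longrightarrow> avg (\<lambda>g. c * u g) g = c * avg u g"
  unfolding avg_def using suminf_mult[OF summable_avg, of u g c] by (simp add: mult_ac)

lemma avg_le:
  assumes "continuous_on G u" "\<And>g. g \<in> G \<Longrightarrow> u g \<le> r" "g \<in> G"
  shows "avg u g \<le> r - (1/2)^Suc j * (r - u (dense_seq j \<cdot> g))"
proof -
  obtain B where B: "\<And>g k. g \<in> G \<Longrightarrow> \<bar>u (dense_seq k \<cdot> g)\<bar> \<le> B"
    using bounded_translates[OF assms(1)] by blast
  show ?thesis
    unfolding avg_def
    using B[OF assms(3)] assms(2)[OF mul_closed[OF dense_seq(1) assms(3)]]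
    by (rule suminf_halves_le[of "\<lambda>k. u (dense_seq k \<cdot> g)"])
qed

lemma avg_upper:
  assumes "continuous_on G u" "\<And>g. g \<in> G \<Longrightarrow> u g \<le> r" "g \<in> G"
  shows "avg u g \<le> r"
proof -
  have "0 \<le> (1/2)^Suc 0 * (r - u (dense_seq 0 \<cdot> g))"
    using assms mul_closed dense_seq(1) by simp
  then show ?thesis
    using avg_le[OF assms, of 0] by linarith
qed

lemma avg_mono:
  assumes "continuous_on G u" "continuous_on G v" "\<And>g. g \<in> G \<Longrightarrow> u g \<le> v g" "g \<in> G"
  shows "avg u g \<le> avg v g"
  unfolding avg_def using assms mul_closed dense_seq(1)
  by (intro suminf_le summable_avg mult_left_mono) auto

lemma avg_lower:
  assumes "continuous_on G u" "\<And>g. g \<in> G \<Longrightarrow> l \<le> u g" "g \<in> G"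
  shows "l \<le> avg u g"
  using avg_mono[of "\<lambda>_. l" u g] assms by (simp add: avg_def suminf_halves_const del: power_Suc)

text \<open>The map sending \<open>(t, g)\<close> to \<open>u (t \<cdot> g)\<close> is uniformly
  continuous on the compact product; comparing pairs with equal first coordinate gives a
  \<open>\<delta>\<close> independent of \<open>t\<close>.\<close>

lemma continuous_imp_modulus:
  assumes "continuous_on G u" "0 < \<eta>"
  obtains \<delta> where "0 < \<delta>" "modulus u \<delta> \<eta>"
proof -
  have "continuous_on (G \<times> G) (u \<circ> (\<lambda>(g, h). g \<cdot> h))"
    using mul_closed by (intro continuous_on_compose continuous_mul continuous_on_subset[OF assms(1)]) auto
  then have "uniformly_continuous_on (G \<times> G) (u \<circ> (\<lambda>(g, h). g \<cdot> h))"
    using compact by (intro compact_uniformly_continuous compact_Times)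
  then obtain \<delta> where \<delta>: "0 < \<delta>" and unif: "\<And>p q. \<lbrakk>p \<in> G \<times> G; q \<in> G \<times> G; dist q p < \<delta>\<rbrakk>
      \<Longrightarrow> dist ((u \<circ> (\<lambda>(g, h). g \<cdot> h)) q) ((u \<circ> (\<lambda>(g, h). g \<cdot> h)) p) < \<eta>"
    unfolding uniformly_continuous_on_def using \<open>0 < \<eta>\<close> by metis
  have "\<bar>u (t \<cdot> g) - u (t \<cdot> h)\<bar> \<le> \<eta>" if "t \<in> G" "g \<in> G" "h \<in> G" "dist g h < \<delta>" for t g h
    using unif[of "(t, h)" "(t, g)"] that by (auto simp: dist_Pair_Pair dist_real_def)
  then show thesis
    using that \<delta> unfolding modulus_def by blast
qed

lemma modulus_imp_continuous:
  assumes "\<And>\<eta>. 0 < \<eta> \<Longrightarrow> \<exists>\<delta>>0. modulus u \<delta> \<eta>"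
  shows "continuous_on G u"
  unfolding continuous_on_iff
proof (intro ballI allI impI)
  fix g \<eta> :: "_" and \<epsilon> :: real assume g: "g \<in> G" and "0 < \<epsilon>"
  then obtain \<delta> where \<delta>: "0 < \<delta>" "modulus u \<delta> (\<epsilon>/2)"
    using assms[of "\<epsilon>/2"] by auto
  have "dist (u h) (u g) < \<epsilon>" if "h \<in> G" "dist h g < \<delta>" for h
    using \<delta>(2) g that unit_closed \<open>0 < \<epsilon>\<close> left_unit unfolding modulus_def
    by (force simp: dist_real_def)
  then show "\<exists>d>0. \<forall>h\<in>G. dist h g < d \<longrightarrow> dist (u h) (u g) < \<epsilon>"
    using \<delta>(1) by blast
qed

text \<open>Associativity absorbs \<open>dense_seq k\<close> into the translating element
  \<open>t\<close>, so every term of the series obeys the bound, and a convex combination keeps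
  it.\<close>

lemma modulus_avg:
  assumes "continuous_on G u" "modulus u \<delta> \<eta>"
  shows "modulus (avg u) \<delta> \<eta>"
  unfolding modulus_def
proof (intro ballI impI)
  fix t g h assume G: "t \<in> G" "g \<in> G" "h \<in> G" and "dist g h < \<delta>"
  define a where "a k = u (dense_seq k \<cdot> (t \<cdot> g)) - u (dense_seq k \<cdot> (t \<cdot> h))" for k
  have a: "\<bar>a k\<bar> \<le> \<eta>" for k
    using assms(2) G \<open>dist g h < \<delta>\<close> mul_closed[OF dense_seq(1) G(1)] unfolding modulus_def a_def
    by (simp add: dense_seq(1) flip: assoc)
  have "avg u (t \<cdot> g) - avg u (t \<cdot> h) = (\<Sum>k. (1/2)^Suc k * a k)"
    unfolding avg_def a_def right_diff_distrib
    using assms(1) G mul_closed by (intro suminf_diff summable_avg) auto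
  moreover have "(\<Sum>k. (1/2)^Suc k * a k) \<le> (\<Sum>k. (1/2)^Suc k * \<eta>)"
    using order_trans[OF abs_ge_zero a] a
    by (intro suminf_le summable_halves[of _ \<eta>] mult_left_mono)
      (auto simp: abs_le_iff minus_le_iff)
  moreover have "(\<Sum>k. (1/2)^Suc k * (- \<eta>)) \<le> (\<Sum>k. (1/2)^Suc k * a k)"
    using order_trans[OF abs_ge_zero a] a
    by (intro suminf_le summable_halves[of _ \<eta>] mult_left_mono)
      (auto simp: abs_le_iff minus_le_iff)
  ultimately show "\<bar>avg u (t \<cdot> g) - avg u (t \<cdot> h)\<bar> \<le> \<eta>"
    unfolding suminf_halves_const by linarith
qed

lemma continuous_avg: "continuous_on G u \<Longrightarrow> continuous_on G (avg u)"
  by (metis continuous_imp_modulus modulus_avg modulus_imp_continuous)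

lemma continuous_avg_pow: "continuous_on G u \<Longrightarrow> continuous_on G ((avg ^^ k) u)"
  by (induction k) (auto intro: continuous_avg)

lemma modulus_avg_pow: "\<lbrakk>continuous_on G u; modulus u \<delta> \<eta>\<rbrakk> \<Longrightarrow> modulus ((avg ^^ k) u) \<delta> \<eta>"
  by (induction k) (auto intro: modulus_avg continuous_avg_pow)

text \<open>Finitely many elements of the dense sequence form a net of the group. For given
  \<open>g\<close> and \<open>g\<^sub>0\<close>, one of them carries \<open>g\<close> to within
  \<open>\<delta>\<close> of \<open>g\<^sub>0\<close>, where \<open>u\<close> exceeds
  \<open>u g\<^sub>0\<close> by at most \<open>\<eta>\<close>; this term of the average has at least
  the weight of the last element of the net. As \<open>w\<close> depends on \<open>\<delta>\<close>
  alone, the same gain applies to every iterate.\<close>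

lemma avg_contracts:
  assumes "0 < \<delta>"
  obtains w where "0 < w"
    "\<And>u r \<eta> g\<^sub>0 g. \<lbrakk>continuous_on G u; modulus u \<delta> \<eta>; \<And>g. g \<in> G \<Longrightarrow> u g \<le> r; g\<^sub>0 \<in> G;
        u g\<^sub>0 + \<eta> \<le> r; g \<in> G\<rbrakk> \<Longrightarrow> avg u g \<le> r - w * (r - u g\<^sub>0 - \<eta>)"
proof -
  have "uniformly_continuous_on (G \<times> G) (\<lambda>(g, h). g \<cdot> h)"
    using compact continuous_mul by (intro compact_uniformly_continuous compact_Times)
  then obtain \<delta>' where "0 < \<delta>'" and unif: "\<And>p q. \<lbrakk>p \<in> G \<times> G; q \<in> G \<times> G; dist q p < \<delta>'\<rbrakk>
      \<Longrightarrow> dist ((\<lambda>(g, h). g \<cdot> h) q) ((\<lambda>(g, h). g \<cdot> h) p) < \<delta>"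
    unfolding uniformly_continuous_on_def using \<open>0 < \<delta>\<close> by metis
  have near: "dist (s \<cdot> g) (t \<cdot> g) < \<delta>" if "s \<in> G" "t \<in> G" "g \<in> G" "dist s t < \<delta>'" for s t g
    using unif[of "(t, g)" "(s, g)"] that by (auto simp: dist_Pair_Pair)
  have "G \<subseteq> (\<Union>k. ball (dense_seq k) \<delta>')"
  proof
    fix g assume "g \<in> G"
    then have "g \<in> closure (range dense_seq)"
      using dense_seq(2) by auto
    then show "g \<in> (\<Union>k. ball (dense_seq k) \<delta>')"
      using \<open>0 < \<delta>'\<close> unfolding closure_approachable by auto
  qed
  then obtain K where K: "finite K" "G \<subseteq> (\<Union>k\<in>K. ball (dense_seq k) \<delta>')"
    using compactE_image[OF compact, of UNIV "\<lambda>k. ball (dense_seq k) \<delta>'"] by auto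
  define w :: real where "w = (1/2)^Suc (Max K)"
  show thesis
  proof
    show "0 < w"
      by (simp add: w_def)
    fix u r \<eta> g\<^sub>0 g
    assume u: "continuous_on G u" "modulus u \<delta> \<eta>" "\<And>g. g \<in> G \<Longrightarrow> u g \<le> r"
      and g: "g\<^sub>0 \<in> G" "u g\<^sub>0 + \<eta> \<le> r" "g \<in> G"
    define t where "t = g\<^sub>0 \<cdot> iv g"
    have t: "t \<in> G" "t \<cdot> g = g\<^sub>0"
      using g mul_closed iv_closed by (auto simp: t_def assoc left_iv right_unit)
    obtain k where k: "k \<in> K" "dist (dense_seq k) t < \<delta>'"
      using subsetD[OF K(2) t(1)] by auto
    have "dist (dense_seq k \<cdot> g) g\<^sub>0 < \<delta>"
      using near[OF dense_seq(1) t(1) g(3) k(2)] t by simp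
    then have "\<bar>u (dense_seq k \<cdot> g) - u g\<^sub>0\<bar> \<le> \<eta>"
      using u(2) unit_closed g mul_closed[OF dense_seq(1) g(3)] left_unit unfolding modulus_def by metis
    then have 1: "r - u g\<^sub>0 - \<eta> \<le> r - u (dense_seq k \<cdot> g)"
      by linarith
    have "k \<le> Max K"
      using K(1) k(1) by simp
    then have "w \<le> (1/2)^Suc k"
      unfolding w_def by (intro power_decreasing) auto
    then have "w * (r - u g\<^sub>0 - \<eta>) \<le> (1/2)^Suc k * (r - u (dense_seq k \<cdot> g))"
      using 1 g(2) \<open>0 < w\<close> by (intro mult_mono) auto
    then show "avg u g \<le> r - w * (r - u g\<^sub>0 - \<eta>)"
      using avg_le[OF u(1,3) g(3), of k] by linarith
  qed
qed

lemma avg_pow_upper: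
  assumes "continuous_on G u" "\<And>g. g \<in> G \<Longrightarrow> (avg ^^ k) u g \<le> r" "k \<le> j" "g \<in> G"
  shows "(avg ^^ j) u g \<le> r"
  using assms(3,4)
proof (induction j arbitrary: g rule: dec_induct)
  case (step j)
  then show ?case
    using avg_upper[OF continuous_avg_pow[OF assms(1)]] by simp
qed (use assms in auto)

lemma avg_pow_lower:
  assumes "continuous_on G u" "\<And>g. g \<in> G \<Longrightarrow> l \<le> (avg ^^ k) u g" "k \<le> j" "g \<in> G"
  shows "l \<le> (avg ^^ j) u g"
  using assms(3,4)
proof (induction j arbitrary: g rule: dec_induct)
  case (step j)
  then show ?case
    using avg_lower[OF continuous_avg_pow[OF assms(1)]] by simp
qed (use assms in auto)

text \<open>Were the oscillation always at least \<open>\<epsilon>\<close>, each iterate would have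
  a value at least \<open>\<epsilon>\<close> below its current upper bound. Half of this gap pays
  for the modulus, and the other half lowers the upper bound of the next iterate by the fixed amount
  \<open>w * (\<epsilon>/2)\<close>. The iterates, however, never fall below a lower bound of
  \<open>u\<close>.\<close>

lemma oscillation_avg_pow:
  assumes u: "continuous_on G u" and "0 < \<epsilon>"
  shows "\<exists>k. \<forall>g\<in>G. \<forall>h\<in>G. (avg ^^ k) u g - (avg ^^ k) u h < \<epsilon>"
proof (rule ccontr)
  assume "\<not> ?thesis"
  then have osc: "\<exists>g\<in>G. \<exists>h\<in>G. \<epsilon> \<le> (avg ^^ k) u g - (avg ^^ k) u h" for k
    by (meson linorder_not_less)
  obtain \<delta> where \<delta>: "0 < \<delta>" "modulus u \<delta> (\<epsilon>/2)"
    using continuous_imp_modulus[OF u] \<open>0 < \<epsilon>\<close> half_gt_zero by metis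
  obtain w where "0 < w" and w:
    "\<And>u r \<eta> g\<^sub>0 g. \<lbrakk>continuous_on G u; modulus u \<delta> \<eta>; \<And>g. g \<in> G \<Longrightarrow> u g \<le> r; g\<^sub>0 \<in> G;
        u g\<^sub>0 + \<eta> \<le> r; g \<in> G\<rbrakk> \<Longrightarrow> avg u g \<le> r - w * (r - u g\<^sub>0 - \<eta>)"
    using avg_contracts[OF \<delta>(1)] by metis
  have "bounded (u ` G)"
    using u compact by (intro compact_imp_bounded compact_continuous_image)
  then obtain B where B: "\<And>g. g \<in> G \<Longrightarrow> \<bar>u g\<bar> \<le> B"
    unfolding bounded_iff by auto
  have upper: "g \<in> G \<Longrightarrow> (avg ^^ k) u g \<le> B - of_nat k * (w * (\<epsilon>/2))" for g k
  proof (induction k arbitrary: g)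
    case 0
    then show ?case
      using B[of g] by simp
  next
    case (Suc k)
    let ?r = "B - of_nat k * (w * (\<epsilon>/2))"
    obtain g\<^sub>1 g\<^sub>0 where g: "g\<^sub>1 \<in> G" "g\<^sub>0 \<in> G" "\<epsilon> \<le> (avg ^^ k) u g\<^sub>1 - (avg ^^ k) u g\<^sub>0"
      using osc by blast
    then have *: "(avg ^^ k) u g\<^sub>0 + \<epsilon>/2 \<le> ?r - \<epsilon>/2"
      using Suc.IH[OF g(1)] by linarith
    have "avg ((avg ^^ k) u) g \<le> ?r - w * (?r - (avg ^^ k) u g\<^sub>0 - \<epsilon>/2)"
      using Suc.IH g(2) Suc.prems * \<open>0 < \<epsilon>\<close>
      by (intro w continuous_avg_pow modulus_avg_pow u \<delta>(2)) auto
    also have "\<dots> \<le> ?r - w * (\<epsilon>/2)"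
      using * \<open>0 < w\<close> by (intro diff_left_mono mult_left_mono) auto
    finally show ?case
      by (simp add: algebra_simps add_divide_distrib)
  qed
  have "0 < w * (\<epsilon>/2)"
    using \<open>0 < w\<close> \<open>0 < \<epsilon>\<close> by simp
  then obtain k where "2 * B < of_nat k * (w * (\<epsilon>/2))"
    using reals_Archimedean3 by blast
  moreover have "- B \<le> (avg ^^ k) u e"
    using B by (intro avg_pow_lower[OF u _ le0 unit_closed]) (auto simp: abs_le_iff minus_le_iff)
  ultimately show False
    using upper[OF unit_closed, of k] by linarith
qed

section \<open>The mean as the common limit of the iterates\<close>

definition mean :: "('a \<Rightarrow> real) \<Rightarrow> real" where
  "mean u = lim (\<lambda>k. (avg ^^ k) u e)"

text \<open>Upper and lower bounds valid on the whole group persist under further averaging. Once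
  the oscillation is below \<open>\<epsilon>/3\<close>, all later values at all points stay within
  \<open>\<epsilon>/3\<close> of one number, hence within \<open>2\<epsilon>/3\<close> of each
  other.\<close>

lemma avg_pow_eventually_close:
  assumes u: "continuous_on G u" and "0 < \<epsilon>"
  shows "\<exists>N. \<forall>i\<ge>N. \<forall>j\<ge>N. \<forall>g\<in>G. \<forall>h\<in>G. \<bar>(avg ^^ i) u g - (avg ^^ j) u h\<bar> < \<epsilon>"
proof -
  obtain N where N: "\<And>g h. \<lbrakk>g \<in> G; h \<in> G\<rbrakk> \<Longrightarrow> (avg ^^ N) u g - (avg ^^ N) u h < \<epsilon>/3"
    using oscillation_avg_pow[OF u, of "\<epsilon>/3"] \<open>0 < \<epsilon>\<close> by auto
  let ?c = "(avg ^^ N) u e"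
  have close: "\<bar>(avg ^^ j) u g - ?c\<bar> \<le> \<epsilon>/3" if "j \<ge> N" "g \<in> G" for j g
  proof -
    have "(avg ^^ N) u h \<le> ?c + \<epsilon>/3" "?c - \<epsilon>/3 \<le> (avg ^^ N) u h" if "h \<in> G" for h
      using N[OF that unit_closed] N[OF unit_closed that] by linarith+
    then have "(avg ^^ j) u g \<le> ?c + \<epsilon>/3" "?c - \<epsilon>/3 \<le> (avg ^^ j) u g"
      using avg_pow_upper[OF u _ that] avg_pow_lower[OF u _ that] by blast+
    then show ?thesis
      by linarith
  qed
  have "\<bar>(avg ^^ i) u g - (avg ^^ j) u h\<bar> < \<epsilon>" if "i \<ge> N" "j \<ge> N" "g \<in> G" "h \<in> G" for i j g h
    using close[OF that(1,3)] close[OF that(2,4)] \<open>0 < \<epsilon>\<close> by linarith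
  then show ?thesis
    by blast
qed

lemma avg_pow_LIMSEQ:
  assumes u: "continuous_on G u" and g: "g \<in> G"
  shows "(\<lambda>k. (avg ^^ k) u g) \<longlonglongrightarrow> mean u"
proof -
  have "Cauchy (\<lambda>k. (avg ^^ k) u e)"
    unfolding Cauchy_def dist_real_def using avg_pow_eventually_close[OF u] unit_closed by blast
  then have *: "(\<lambda>k. (avg ^^ k) u e) \<longlonglongrightarrow> mean u"
    unfolding mean_def by (simp add: Cauchy_convergent_iff convergent_LIMSEQ_iff)
  have "(\<lambda>k. (avg ^^ k) u g - (avg ^^ k) u e) \<longlonglongrightarrow> 0"
    unfolding LIMSEQ_def dist_real_def using avg_pow_eventually_close[OF u] unit_closed g by fastforce
  from tendsto_add[OF this *] show ?thesis
    by simp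
qed

lemma avg_pow_add:
  assumes "continuous_on G u" "continuous_on G v" "g \<in> G"
  shows "(avg ^^ k) (\<lambda>g. u g + v g) g = (avg ^^ k) u g + (avg ^^ k) v g"
  using assms(3)
proof (induction k arbitrary: g)
  case (Suc k)
  have "(avg ^^ Suc k) (\<lambda>g. u g + v g) g = avg (\<lambda>g. (avg ^^ k) u g + (avg ^^ k) v g) g"
    using Suc by (auto intro: avg_cong)
  then show ?case
    using Suc.prems assms by (simp add: avg_add continuous_avg_pow)
qed simp

lemma avg_pow_scale:
  assumes "continuous_on G u" "g \<in> G"
  shows "(avg ^^ k) (\<lambda>g. c * u g) g = c * (avg ^^ k) u g"
  using assms(2)
proof (induction k arbitrary: g)
  case (Suc k)
  have "(avg ^^ Suc k) (\<lambda>g. c * u g) g = avg (\<lambda>g. c * (avg ^^ k) u g) g"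
    using Suc by (auto intro: avg_cong)
  then show ?case
    using Suc.prems assms by (simp add: avg_scale continuous_avg_pow)
qed simp

lemma avg_pow_mono:
  assumes "continuous_on G u" "continuous_on G v" "\<And>g. g \<in> G \<Longrightarrow> u g \<le> v g" "g \<in> G"
  shows "(avg ^^ k) u g \<le> (avg ^^ k) v g"
  using assms(4)
  by (induction k arbitrary: g) (auto intro: avg_mono assms continuous_avg_pow)

text \<open>Averaging uses left translations, and these commute with right translations by
  associativity.\<close>

lemma avg_pow_translate:
  assumes "h \<in> G" "g \<in> G"
  shows "(avg ^^ k) (\<lambda>g. u (g \<cdot> h)) g = (avg ^^ k) u (g \<cdot> h)"
  using assms(2)
proof (induction k arbitrary: g)
  case (Suc k)
  have "(avg ^^ Suc k) (\<lambda>g. u (g \<cdot> h)) g = avg (\<lambda>g. (avg ^^ k) u (g \<cdot> h)) g"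
    using Suc by (auto intro: avg_cong)
  also have "\<dots> = avg ((avg ^^ k) u) (g \<cdot> h)"
    unfolding avg_def using Suc.prems assms(1) dense_seq(1) by (simp add: assoc)
  finally show ?case
    by simp
qed simp

lemma continuous_translate:
  assumes "continuous_on G u" "h \<in> G"
  shows "continuous_on G (\<lambda>g. u (g \<cdot> h))"
proof -
  have "continuous_on G (\<lambda>g. (\<lambda>(g, h). g \<cdot> h) (g, h))"
    using assms(2) by (intro continuous_on_compose2[OF continuous_mul] continuous_intros) auto
  then show ?thesis
    using assms mul_closed by (auto intro: continuous_on_compose2[OF assms(1)])
qed

text \<open>At the unit, the iterates of the right translate are the iterates of \<open>u\<close> at
  \<open>h\<close>, and the limit of the latter does not depend on the point.\<close>

lemma mean_translate:
  assumes "continuous_on G u" "h \<in> G"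
  shows "mean (\<lambda>g. u (g \<cdot> h)) = mean u"
proof -
  have "(\<lambda>k. (avg ^^ k) u (e \<cdot> h)) \<longlonglongrightarrow> mean (\<lambda>g. u (g \<cdot> h))"
    using avg_pow_LIMSEQ[OF continuous_translate[OF assms] unit_closed]
    by (simp add: avg_pow_translate assms unit_closed)
  then show ?thesis
    using avg_pow_LIMSEQ[OF assms] LIMSEQ_unique assms(2) left_unit by metis
qed

sublocale mean_functional G mean
proof
  fix u v :: "'a \<Rightarrow> real" and c assume u: "continuous_on G u"
  show "mean (\<lambda>g. c * u g) = c * mean u"
    using avg_pow_LIMSEQ[OF continuous_on_mult_left[OF u, of c] unit_closed] tendsto_mult_left[OF avg_pow_LIMSEQ[OF u unit_closed], of c]
    by (intro LIMSEQ_unique) (auto simp: avg_pow_scale u unit_closed)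
  assume v: "continuous_on G v"
  show "mean (\<lambda>g. u g + v g) = mean u + mean v"
    using avg_pow_LIMSEQ[OF continuous_on_add[OF u v] unit_closed]
      tendsto_add[OF avg_pow_LIMSEQ[OF u unit_closed] avg_pow_LIMSEQ[OF v unit_closed]]
    by (intro LIMSEQ_unique) (auto simp: avg_pow_add u v unit_closed)
  assume "\<And>g. g \<in> G \<Longrightarrow> u g \<le> v g"
  then have "(avg ^^ k) u e \<le> (avg ^^ k) v e" for k
    by (rule avg_pow_mono[OF u v _ unit_closed])
  then show "mean u \<le> mean v"
    using LIMSEQ_le[OF avg_pow_LIMSEQ[OF u unit_closed] avg_pow_LIMSEQ[OF v unit_closed]] by blast
next
  have "(avg ^^ k) (\<lambda>_. 1) e = 1" for k
    using avg_pow_upper[of "\<lambda>_. 1" 0 1 k e] avg_pow_lower[of "\<lambda>_. 1" 1 0 k e]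
    by (simp add: unit_closed)
  then show "mean (\<lambda>_. 1) = 1"
    by (simp add: mean_def)
qed

text \<open>For \<open>- u\<close>, the contraction estimate with upper bound 0 and
  \<open>\<eta>\<close> equal to half of \<open>u g\<^sub>0\<close> puts all values below a negative
  constant after one averaging, and later averages preserve this bound. The result makes division by
  the mean of a weight legitimate.\<close>

lemma mean_pos:
  assumes u: "continuous_on G u" "\<And>g. g \<in> G \<Longrightarrow> 0 \<le> u g" "g\<^sub>0 \<in> G" "0 < u g\<^sub>0"
  shows "0 < mean u"
proof -
  define v where "v g = - 1 * u g" for g
  have v: "continuous_on G v" "\<And>g. g \<in> G \<Longrightarrow> v g \<le> 0" "v g\<^sub>0 < 0"
    unfolding v_def using assms by (auto intro!: continuous_intros)
  obtain \<delta> where \<delta>: "0 < \<delta>" "modulus v \<delta> (- v g\<^sub>0 / 2)"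
    using continuous_imp_modulus[OF v(1), of "- v g\<^sub>0 / 2"] v(3) by auto
  obtain w where "0 < w" and w:
    "\<And>u r \<eta> g\<^sub>0 g. \<lbrakk>continuous_on G u; modulus u \<delta> \<eta>; \<And>g. g \<in> G \<Longrightarrow> u g \<le> r; g\<^sub>0 \<in> G;
        u g\<^sub>0 + \<eta> \<le> r; g \<in> G\<rbrakk> \<Longrightarrow> avg u g \<le> r - w * (r - u g\<^sub>0 - \<eta>)"
    using avg_contracts[OF \<delta>(1)] by metis
  have "avg v g \<le> w * (v g\<^sub>0 / 2)" if "g \<in> G" for g
    using w[OF v(1) \<delta>(2) v(2) assms(3) _ that] v(3) by simp
  then have "(avg ^^ k) v e \<le> w * (v g\<^sub>0 / 2)" if "k \<ge> 1" for k
    using avg_pow_upper[OF v(1) _ that unit_closed, of "w * (v g\<^sub>0 / 2)"] by simp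
  then have "mean v \<le> w * (v g\<^sub>0 / 2)"
    using avg_pow_LIMSEQ[OF v(1) unit_closed] by (intro LIMSEQ_le_const2) auto
  moreover have "mean v = - 1 * mean u"
    unfolding v_def by (rule scale[OF assms(1)])
  moreover have "w * (v g\<^sub>0 / 2) < 0"
    using \<open>0 < w\<close> v(3) by (simp add: mult_less_0_iff)
  ultimately show ?thesis
    by simp
qed

end


subsection \<open>Norms on subspaces and duals\<close>

locale normed_subspace =
  fixes X :: "'v::real_vector set" and N :: "'v \<Rightarrow> real"
  assumes subspace: "subspace X"
    and nonneg: "x \<in> X \<Longrightarrow> 0 \<le> N x"
    and definite: "\<lbrakk>x \<in> X; N x = 0\<rbrakk> \<Longrightarrow> x = 0"
    and scale: "x \<in> X \<Longrightarrow> N (c *\<^sub>R x) = \<bar>c\<bar> * N x"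
    and triangle: "\<lbrakk>x \<in> X; y \<in> X\<rbrakk> \<Longrightarrow> N (x + y) \<le> N x + N y"
begin

lemma zero [simp]: "N 0 = 0"
  using scale[of 0 0] subspace by (simp add: subspace_0)

lemma diff_triangle:
  assumes "x \<in> X" "y \<in> X" "z \<in> X"
  shows "N (x - z) \<le> N (x - y) + N (y - z)"
  using triangle[of "x - y" "y - z"] assms subspace by (simp add: subspace_diff)

lemma diff_commute: "\<lbrakk>x \<in> X; y \<in> X\<rbrakk> \<Longrightarrow> N (x - y) = N (y - x)"
  using scale[of "y - x" "-1"] subspace by (simp add: subspace_diff)

lemma metric_space: "Metric_space X (norm_dist X N)"
proof
  fix x y z
  show "0 \<le> norm_dist X N x y"
    using nonneg subspace by (simp add: norm_dist_def subspace_diff)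
  show "norm_dist X N x y = norm_dist X N y x"
    using diff_commute by (simp add: norm_dist_def)
  assume "x \<in> X" "y \<in> X"
  then show "norm_dist X N x y = 0 \<longleftrightarrow> x = y"
    using definite[of "x - y"] subspace by (auto simp: norm_dist_def subspace_diff)
  assume "z \<in> X"
  then show "norm_dist X N x z \<le> norm_dist X N x y + norm_dist X N y z"
    using \<open>x \<in> X\<close> \<open>y \<in> X\<close> diff_triangle by (simp add: norm_dist_def)
qed

sublocale metric: Metric_space X "norm_dist X N"
  by (rule metric_space)

lemma in_closure:
  assumes "Y \<subseteq> X"
  shows "x \<in> norm_topology X N closure_of Y \<longleftrightarrow> x \<in> X \<and> (\<forall>\<epsilon>>0. \<exists>y\<in>Y. N (x - y) < \<epsilon>)"
  using assms unfolding norm_topology_def metric.metric_closure_of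
  by (auto simp: norm_dist_def subset_iff; metis)

lemma subspace_closure:
  assumes "subspace Y" "Y \<subseteq> X"
  shows "subspace (norm_topology X N closure_of Y)"
proof (rule subspaceI)
  show "0 \<in> norm_topology X N closure_of Y"
    unfolding in_closure[OF assms(2)] using assms subspace
    by (auto simp: subspace_0 intro!: bexI[of _ 0])
next
  fix x y assume x: "x \<in> norm_topology X N closure_of Y" and y: "y \<in> norm_topology X N closure_of Y"
  have "\<exists>v\<in>Y. N (x + y - v) < \<epsilon>" if \<epsilon>: "0 < \<epsilon>" for \<epsilon>
  proof -
    obtain a b where ab: "a \<in> Y" "b \<in> Y" "N (x - a) < \<epsilon>/2" "N (y - b) < \<epsilon>/2"
      using x y half_gt_zero[OF \<epsilon>] unfolding in_closure[OF assms(2)] by blast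
    have "N (x + y - (a + b)) \<le> N (x - a) + N (y - b)"
      using triangle[of "x - a" "y - b"] ab x y assms(2) subspace
      unfolding in_closure[OF assms(2)] by (simp add: subspace_diff subset_iff algebra_simps)
    then show ?thesis
      using ab assms(1) subspace_add by (intro bexI[of _ "a + b"]) auto
  qed
  then show "x + y \<in> norm_topology X N closure_of Y"
    using x y subspace unfolding in_closure[OF assms(2)] by (simp add: subspace_add)
next
  fix c x assume x: "x \<in> norm_topology X N closure_of Y"
  have "\<exists>v\<in>Y. N (c *\<^sub>R x - v) < \<epsilon>" if "0 < \<epsilon>" for \<epsilon>
  proof -
    \<comment> \<open>The summand 1 covers the case \<open>c = 0\<close>.\<close>
    have "0 < \<epsilon> / (\<bar>c\<bar> + 1)"
      using that by (simp add: add_nonneg_pos)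
    then obtain a where a: "a \<in> Y" "N (x - a) < \<epsilon> / (\<bar>c\<bar> + 1)"
      using x unfolding in_closure[OF assms(2)] by blast
    have "x - a \<in> X"
      using a(1) x assms(2) subspace unfolding in_closure[OF assms(2)] by (auto simp: subspace_diff)
    then have "N (c *\<^sub>R x - c *\<^sub>R a) = \<bar>c\<bar> * N (x - a)" "0 \<le> N (x - a)"
      by (simp_all add: scale nonneg flip: scaleR_diff_right)
    moreover have "(\<bar>c\<bar> + 1) * N (x - a) < \<epsilon>"
      using a(2) by (simp add: pos_less_divide_eq mult.commute)
    ultimately show ?thesis
      using a(1) assms(1) subspace_scale by (intro bexI[of _ "c *\<^sub>R a"]) (auto simp: distrib_right)
  qed
  then show "c *\<^sub>R x \<in> norm_topology X N closure_of Y"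
    using x subspace unfolding in_closure[OF assms(2)] by (simp add: subspace_scale)
qed

lemma normed_subspace_subset: "\<lbrakk>subspace Y; Y \<subseteq> X\<rbrakk> \<Longrightarrow> normed_subspace Y N"
  by unfold_locales (auto intro: nonneg definite scale triangle)

lemma compactin_net:
  assumes "compactin (norm_topology X N) K" "0 < \<epsilon>"
  obtains C where "finite C" "C \<subseteq> X" "K \<subseteq> X" "\<And>x. x \<in> K \<Longrightarrow> \<exists>y\<in>C. N (x - y) < \<epsilon>"
proof -
  have "K \<subseteq> X"
    using assms(1) unfolding norm_topology_def by (metis compactin_subset_topspace metric.topspace_mtopology)
  have "metric.mtotally_bounded K"
    using assms(1) unfolding norm_topology_def by (rule metric.compactin_imp_mtotally_bounded)
  then obtain C where C: "finite C" "C \<subseteq> K" "K \<subseteq> (\<Union>y\<in>C. metric.mball y \<epsilon>)"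
    unfolding metric.mtotally_bounded_def using assms(2) by meson
  show thesis
  proof (rule that[of C])
    fix x assume "x \<in> K"
    then obtain y where y: "y \<in> C" "x \<in> metric.mball y \<epsilon>"
      using C(3) by blast
    then have "N (y - x) < \<epsilon>" "x \<in> X" "y \<in> X"
      by (auto simp: norm_dist_def)
    then show "\<exists>y\<in>C. N (x - y) < \<epsilon>"
      using y(1) diff_commute by metis
  qed (use C \<open>K \<subseteq> X\<close> in auto)
qed

text \<open>Contractions are equi-Lipschitz, so it suffices to control them on a finite net of
  \<open>K\<close>, whose points may be replaced by nearby elements of the span of \<open>A\<close>.
  There the error is a fixed multiple of the error on \<open>A\<close>.\<close>

lemma metric_approximation_property_dense:
  assumes A: "A \<subseteq> X" "X \<subseteq> norm_topology X N closure_of span A"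
    and approx: "\<And>\<epsilon>. 0 < \<epsilon> \<Longrightarrow> \<exists>T. bounded_linear_on X N X N T \<and> finite_rank_on X T \<and>
           (\<forall>x\<in>X. N (T x) \<le> N x) \<and> (\<forall>a\<in>A. N (T a - a) \<le> \<epsilon>)"
  shows "metric_approximation_property X N"
  unfolding metric_approximation_property_def
proof (intro allI impI, elim conjE)
  fix K and \<epsilon> :: real
  assume K: "compactin (norm_topology X N) K" and "0 < \<epsilon>"
  have span: "span A \<subseteq> X"
    using A(1) subspace by (rule span_minimal)
  \<comment> \<open>\<open>C\<close> is the sum of the absolute values of the coefficients in some
    expansion of \<open>y\<close>. It is chosen before \<open>T\<close>, because \<open>T\<close>
    will be selected according to it.\<close>
  have growth: "y \<in> X \<and> (\<exists>C\<ge>0. \<forall>T \<delta>. bounded_linear_on X N X N T \<longrightarrow> (\<forall>a\<in>A. N (T a - a) \<le> \<delta>) \<longrightarrow> N (T y - y) \<le> C * \<delta>)"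
    (is "?P y") if "y \<in> span A" for y
    using that
  proof (induction rule: span_induct_alt)
    case base
    have "T 0 = 0" if "bounded_linear_on X N X N T" for T
      using that subspace_0[OF subspace] unfolding bounded_linear_on_def by (metis scaleR_zero_left)
    then show ?case
      using subspace_0[OF subspace] by (intro conjI exI[of _ 0]) (auto, metis diff_zero mult_zero_left order_refl zero)
  next
    case (step c a y)
    then obtain C where "y \<in> X" "C \<ge> 0" and C:
      "\<And>T \<delta>. bounded_linear_on X N X N T \<Longrightarrow> (\<forall>a\<in>A. N (T a - a) \<le> \<delta>) \<Longrightarrow> N (T y - y) \<le> C * \<delta>"
      by blast
    have X: "a \<in> X" "y \<in> X" "c *\<^sub>R a \<in> X"
      using step \<open>y \<in> X\<close> A(1) subspace_scale[OF subspace] by auto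
    have "N (T (c *\<^sub>R a + y) - (c *\<^sub>R a + y)) \<le> (\<bar>c\<bar> + C) * \<delta>"
      if T: "bounded_linear_on X N X N T" "\<forall>a\<in>A. N (T a - a) \<le> \<delta>" for T \<delta>
    proof -
      have TX: "T a \<in> X" "T y \<in> X"
        using T(1) X by (auto simp: bounded_linear_on_def)
      have "T (c *\<^sub>R a + y) - (c *\<^sub>R a + y) = c *\<^sub>R (T a - a) + (T y - y)"
        using T(1) X by (simp add: bounded_linear_on_def algebra_simps)
      also have "N \<dots> \<le> \<bar>c\<bar> * N (T a - a) + N (T y - y)"
        using triangle[of "c *\<^sub>R (T a - a)" "T y - y"] X TX subspace
        by (simp add: scale subspace_diff subspace_scale)
      also have "\<dots> \<le> \<bar>c\<bar> * \<delta> + C * \<delta>"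
        using T step(1) by (intro add_mono mult_left_mono C) auto
      finally show ?thesis
        by (simp add: distrib_right)
    qed
    then show ?case
      using \<open>C \<ge> 0\<close> X subspace_add[OF subspace] by (intro conjI exI[of _ "\<bar>c\<bar> + C"]) auto
  qed
  \<comment> \<open>Two steps of length \<open>\<epsilon>/6\<close> lead from \<open>x\<close>
    through the net to \<open>v y\<close>, so \<open>x\<close> and \<open>v y\<close>, and likewise
    their images, are within \<open>\<epsilon>/3\<close>. With \<open>\<epsilon>/6\<close> for the
    error of \<open>T\<close> at \<open>v y\<close> the total is below
    \<open>\<epsilon>\<close>.\<close>
  obtain Y where Y: "finite Y" "Y \<subseteq> X" "K \<subseteq> X" "\<And>x. x \<in> K \<Longrightarrow> \<exists>y\<in>Y. N (x - y) < \<epsilon>/6"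
    using compactin_net[OF K, of "\<epsilon>/6"] \<open>0 < \<epsilon>\<close> by auto
  have "\<exists>v\<in>span A. N (y - v) < \<epsilon>/6" if "y \<in> Y" for y
    using that Y(2) A(2) \<open>0 < \<epsilon>\<close> unfolding subset_iff in_closure[OF span] by (meson divide_pos_pos zero_less_numeral)
  then obtain v where v: "\<And>y. y \<in> Y \<Longrightarrow> v y \<in> span A" "\<And>y. y \<in> Y \<Longrightarrow> N (y - v y) < \<epsilon>/6"
    by metis
  have "\<forall>y\<in>Y. ?P (v y)"
    using growth v(1) by blast
  then obtain C where C: "\<And>y. y \<in> Y \<Longrightarrow> 0 \<le> C y" "\<And>y T \<delta>. \<lbrakk>y \<in> Y; bounded_linear_on X N X N T; \<forall>a\<in>A. N (T a - a) \<le> \<delta>\<rbrakk>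
      \<Longrightarrow> N (T (v y) - v y) \<le> C y * \<delta>"
    by metis
  \<comment> \<open>A common bound for the finitely many constants; adding 1 keeps it positive even
    if all of them vanish.\<close>
  define m where "m = sum C Y + 1"
  have m: "0 < m" "\<And>y. y \<in> Y \<Longrightarrow> C y \<le> m"
    using C(1) Y(1) member_le_sum[of _ Y C] by (auto simp: m_def sum_nonneg add_nonneg_pos add_increasing2)
  obtain T where T: "bounded_linear_on X N X N T" "finite_rank_on X T" "\<And>x. x \<in> X \<Longrightarrow> N (T x) \<le> N x"
      "\<forall>a\<in>A. N (T a - a) \<le> \<epsilon> / (6 * m)"
    using approx[of "\<epsilon> / (6 * m)"] \<open>0 < \<epsilon>\<close> m(1) by auto
  have "op_norm X N N T \<le> 1"
    unfolding op_norm_def using T(3) by (intro cInf_lower) (auto intro: bdd_belowI)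
  moreover have "N (T x - x) < \<epsilon>" if "x \<in> K" for x
  proof -
    obtain y where y: "y \<in> Y" "N (x - y) < \<epsilon>/6"
      using Y(4)[OF \<open>x \<in> K\<close>] by blast
    have X: "x \<in> X" "y \<in> X" "v y \<in> X"
      using that Y v y(1) span by auto
    have TX: "T x \<in> X" "T (v y) \<in> X"
      using T(1) X by (auto simp: bounded_linear_on_def)
    have xv: "N (x - v y) < \<epsilon>/3"
      using diff_triangle[OF X] y v(2)[OF y(1)] by linarith
    have "T (x - v y) + T (v y) = T x"
      using T(1) X subspace unfolding bounded_linear_on_def by (metis diff_add_cancel subspace_diff)
    then have "N (T x - T (v y)) < \<epsilon>/3"
      using T(3)[of "x - v y"] xv X subspace by (simp add: subspace_diff eq_diff_eq[symmetric])
    moreover have "N (T (v y) - v y) \<le> m * (\<epsilon> / (6 * m))"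
      using C(2)[OF y(1) T(1) T(4)] m(2)[OF y(1)] m(1) \<open>0 < \<epsilon>\<close>
      by (elim order_trans) (intro mult_right_mono, auto)
    moreover have "N (T x - x) \<le> N (T x - T (v y)) + (N (T (v y) - v y) + N (v y - x))"
      using diff_triangle[OF TX(1) TX(2) X(1)] diff_triangle[OF TX(2) X(3) X(1)] by linarith
    ultimately show ?thesis
      using xv diff_commute[OF X(1,3)] m(1) \<open>0 < \<epsilon>\<close> by simp
  qed
  ultimately show "\<exists>T. bounded_linear_on X N X N T \<and> finite_rank_on X T \<and> op_norm X N N T \<le> 1 \<and>
      (\<forall>x\<in>K. N (T x - x) < \<epsilon>)"
    using T(1,2) by blast
qed

end

section \<open>Functionals and the dual norm\<close>

lemma dual_norm_le:
  assumes "0 \<le> B" "\<And>x. x \<in> X \<Longrightarrow> \<bar>\<phi> x\<bar> \<le> B * N x"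
  shows "dual_norm X N \<phi> \<le> B"
  unfolding dual_norm_def op_norm_def using assms by (intro cInf_lower) (auto intro: bdd_belowI)

lemma dual_spaceI:
  assumes "\<And>x y. \<lbrakk>x \<in> X; y \<in> X\<rbrakk> \<Longrightarrow> \<phi> (x + y) = \<phi> x + \<phi> y"
    and "\<And>c x. x \<in> X \<Longrightarrow> \<phi> (c *\<^sub>R x) = c * \<phi> x"
    and "\<And>x. x \<in> X \<Longrightarrow> \<bar>\<phi> x\<bar> \<le> B * N x"
    and "\<And>x. x \<notin> X \<Longrightarrow> \<phi> x = 0"
  shows "\<phi> \<in> dual_space X N"
  using assms by (auto simp: dual_space_def bounded_linear_on_def intro!: exI[of _ B])

lemma dual_space_add: "\<lbrakk>\<phi> \<in> dual_space X N; x \<in> X; y \<in> X\<rbrakk> \<Longrightarrow> \<phi> (x + y) = \<phi> x + \<phi> y"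
  and dual_space_scale: "\<lbrakk>\<phi> \<in> dual_space X N; x \<in> X\<rbrakk> \<Longrightarrow> \<phi> (c *\<^sub>R x) = c * \<phi> x"
  and dual_space_outside: "\<lbrakk>\<phi> \<in> dual_space X N; x \<notin> X\<rbrakk> \<Longrightarrow> \<phi> x = 0"
  by (auto simp: dual_space_def bounded_linear_on_def)

lemma dual_space_sum:
  assumes "\<phi> \<in> dual_space X N" "subspace X" "finite I" "\<And>i. i \<in> I \<Longrightarrow> x i \<in> X"
  shows "\<phi> (\<Sum>i\<in>I. x i) = (\<Sum>i\<in>I. \<phi> (x i))"
  using assms(3,4)
proof (induction I)
  case empty
  show ?case
    using dual_space_scale[OF assms(1) subspace_0[OF assms(2)], of 0] by simp
next
  case (insert i I)
  then show ?case
    using dual_space_add[OF assms(1), of "x i" "\<Sum>i\<in>I. x i"] subspace_sum[OF assms(2), of I x] by simp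
qed

lemma sum_fun_apply: "(\<Sum>i\<in>I. f i) x = (\<Sum>i\<in>I. f i x)"
  by (induction I rule: infinite_finite_induct) auto

locale dual_pair =
  fixes X :: "'v::real_vector set" and N :: "'v \<Rightarrow> real"
  assumes subspace_base: "subspace X" and nonneg_base: "x \<in> X \<Longrightarrow> 0 \<le> N x"
begin

text \<open>If \<open>N x = 0\<close>, any admissible constant forces \<open>\<phi> x = 0\<close>.
  Otherwise the quotient of \<open>\<bar>\<phi> x\<bar>\<close> by \<open>N x\<close> lies below
  every admissible constant, hence below their infimum.\<close>

lemma dual_bounds:
  assumes "\<phi> \<in> dual_space X N"
  shows dual_norm_nonneg: "0 \<le> dual_norm X N \<phi>"
    and dual_norm_bound: "x \<in> X \<Longrightarrow> \<bar>\<phi> x\<bar> \<le> dual_norm X N \<phi> * N x"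
proof -
  let ?S = "{B. 0 \<le> B \<and> (\<forall>x\<in>X. norm (\<phi> x) \<le> B * N x)}"
  obtain B where "\<forall>x\<in>X. norm (\<phi> x) \<le> B * N x"
    using assms by (auto simp: dual_space_def bounded_linear_on_def)
  then have "\<bar>B\<bar> \<in> ?S"
    using nonneg_base by (auto intro: order_trans[OF _ mult_right_mono])
  then have ne: "?S \<noteq> {}"
    by blast
  then show "0 \<le> dual_norm X N \<phi>"
    unfolding dual_norm_def op_norm_def by (rule cInf_greatest) auto
  assume x: "x \<in> X"
  show "\<bar>\<phi> x\<bar> \<le> dual_norm X N \<phi> * N x"
  proof (cases "N x = 0")
    case True
    then show ?thesis
      using \<open>\<bar>B\<bar> \<in> ?S\<close> x by force
  next
    case False
    then have "0 < N x"
      using nonneg_base[OF x] by simp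
    then have "\<bar>\<phi> x\<bar> / N x \<le> dual_norm X N \<phi>"
      unfolding dual_norm_def op_norm_def using x
      by (intro cInf_greatest[OF ne]) (auto simp: pos_divide_le_eq)
    then show ?thesis
      using \<open>0 < N x\<close> by (simp add: pos_divide_le_eq)
  qed
qed

lemma subspace_dual: "subspace (dual_space X N)"
proof (rule subspaceI)
  show "0 \<in> dual_space X N"
    by (rule dual_spaceI[where B=0]) auto
next
  fix \<phi> \<psi> assume \<phi>: "\<phi> \<in> dual_space X N" and \<psi>: "\<psi> \<in> dual_space X N"
  show "\<phi> + \<psi> \<in> dual_space X N"
  proof (rule dual_spaceI[where B="dual_norm X N \<phi> + dual_norm X N \<psi>"])
    fix x assume "x \<in> X"
    then show "\<bar>(\<phi> + \<psi>) x\<bar> \<le> (dual_norm X N \<phi> + dual_norm X N \<psi>) * N x"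
      using dual_norm_bound[OF \<phi>, of x] dual_norm_bound[OF \<psi>, of x] by (simp add: distrib_right)
  qed (use \<phi> \<psi> in \<open>auto simp: dual_space_add dual_space_scale dual_space_outside distrib_left\<close>)
next
  fix c \<phi> assume \<phi>: "\<phi> \<in> dual_space X N"
  show "c *\<^sub>R \<phi> \<in> dual_space X N"
  proof (rule dual_spaceI[where B="\<bar>c\<bar> * dual_norm X N \<phi>"])
    fix x assume "x \<in> X"
    then show "\<bar>(c *\<^sub>R \<phi>) x\<bar> \<le> \<bar>c\<bar> * dual_norm X N \<phi> * N x"
      using dual_norm_bound[OF \<phi>, of x] by (simp add: abs_mult mult.assoc mult_left_mono)
  qed (use \<phi> in \<open>auto simp: dual_space_add dual_space_scale dual_space_outside distrib_left\<close>)
qed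

sublocale dual: normed_subspace "dual_space X N" "dual_norm X N"
proof
  fix \<phi> assume \<phi>: "\<phi> \<in> dual_space X N"
  {
    assume "dual_norm X N \<phi> = 0"
    then have "\<phi> x = 0" for x
      using dual_norm_bound[OF \<phi>, of x] dual_space_outside[OF \<phi>, of x] by (cases "x \<in> X") auto
    then show "\<phi> = 0"
      by (simp add: fun_eq_iff)
  }
  \<comment> \<open>One inequality suffices: for nonzero \<open>c\<close>, applying it with factor
    \<open>1/c\<close> to \<open>c *\<^sub>R \<phi>\<close> gives the reverse.\<close>
  have le: "dual_norm X N (c *\<^sub>R \<psi>) \<le> \<bar>c\<bar> * dual_norm X N \<psi>" if "\<psi> \<in> dual_space X N" for c \<psi>
    using that dual_norm_bound[OF that]
    by (intro dual_norm_le) (auto simp: dual_norm_nonneg abs_mult mult.assoc mult_left_mono)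
  show "dual_norm X N (c *\<^sub>R \<phi>) = \<bar>c\<bar> * dual_norm X N \<phi>" for c
  proof (cases "c = 0")
    case True
    then show ?thesis
      using le[OF \<phi>, of 0] dual_norm_nonneg[OF subspace_0[OF subspace_dual]] by simp
  next
    case False
    then have "dual_norm X N \<phi> \<le> \<bar>1/c\<bar> * dual_norm X N (c *\<^sub>R \<phi>)"
      using le[OF subspace_scale[OF subspace_dual \<phi>], of "1/c" c] by simp
    then show ?thesis
      using False le[OF \<phi>, of c] by (simp add: field_simps abs_mult)
  qed
  fix \<psi> assume \<psi>: "\<psi> \<in> dual_space X N"
  show "dual_norm X N (\<phi> + \<psi>) \<le> dual_norm X N \<phi> + dual_norm X N \<psi>"
  proof (rule dual_norm_le)
    fix x assume "x \<in> X"
    then show "\<bar>(\<phi> + \<psi>) x\<bar> \<le> (dual_norm X N \<phi> + dual_norm X N \<psi>) * N x"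
      using dual_norm_bound[OF \<phi>, of x] dual_norm_bound[OF \<psi>, of x] by (simp add: distrib_right)
  qed (use \<phi> \<psi> in \<open>simp add: dual_norm_nonneg\<close>)
qed (auto simp: subspace_dual dual_norm_nonneg)

end

section \<open>Adjoints of linear contractions\<close>

locale linear_contraction = dual_pair X N for X :: "'v::real_vector set" and N :: "'v \<Rightarrow> real" +
  fixes S :: "'v \<Rightarrow> 'v"
  assumes closed: "x \<in> X \<Longrightarrow> S x \<in> X"
    and add: "\<lbrakk>x \<in> X; y \<in> X\<rbrakk> \<Longrightarrow> S (x + y) = S x + S y"
    and scale: "x \<in> X \<Longrightarrow> S (c *\<^sub>R x) = c *\<^sub>R S x"
    and contracts: "x \<in> X \<Longrightarrow> N (S x) \<le> N x"
begin

definition adjoint_map :: "('v \<Rightarrow> real) \<Rightarrow> 'v \<Rightarrow> real" where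
  "adjoint_map \<phi> = (\<lambda>x. if x \<in> X then \<phi> (S x) else 0)"

lemma
  assumes \<phi>: "\<phi> \<in> dual_space X N"
  shows adjoint_map_closed: "adjoint_map \<phi> \<in> dual_space X N"
    and adjoint_map_contracts: "dual_norm X N (adjoint_map \<phi>) \<le> dual_norm X N \<phi>"
proof -
  have *: "\<bar>adjoint_map \<phi> x\<bar> \<le> dual_norm X N \<phi> * N x" if "x \<in> X" for x
  proof -
    have "\<bar>\<phi> (S x)\<bar> \<le> dual_norm X N \<phi> * N (S x)"
      using \<phi> that closed by (intro dual_norm_bound) auto
    also have "\<dots> \<le> dual_norm X N \<phi> * N x"
      using contracts[OF that] \<phi> by (intro mult_left_mono) (auto simp: dual_norm_nonneg)
    finally show ?thesis
      using that by (simp add: adjoint_map_def)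
  qed
  then show "dual_norm X N (adjoint_map \<phi>) \<le> dual_norm X N \<phi>"
    using \<phi> by (intro dual_norm_le) (auto simp: dual_norm_nonneg)
  show "adjoint_map \<phi> \<in> dual_space X N"
    using * \<phi> subspace_base
    by (intro dual_spaceI[where B="dual_norm X N \<phi>"])
      (auto simp: adjoint_map_def closed add scale dual_space_add dual_space_scale subspace_add subspace_scale)
qed

lemma adjoint_map_add: "adjoint_map (\<phi> + \<psi>) = adjoint_map \<phi> + adjoint_map \<psi>"
  and adjoint_map_scale: "adjoint_map (c *\<^sub>R \<phi>) = c *\<^sub>R adjoint_map \<phi>"
  by (auto simp: adjoint_map_def fun_eq_iff)

text \<open>The set \<open>C\<close> need not lie in \<open>X\<close>, so a functional cannot be
  expanded through its values there. A maximal independent subset \<open>B\<close> of the image does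
  lie in \<open>X\<close>, and it is finite, being independent in a finitely generated span. The
  coordinates of \<open>S x\<close> with respect to \<open>B\<close> give fixed functions
  \<open>\<gamma> b\<close>, and \<open>\<phi> b\<close> are the coefficients.\<close>

lemma adjoint_map_finite_rank:
  assumes "finite C" "S ` X \<subseteq> span C"
  shows "finite_rank_on (dual_space X N) adjoint_map"
proof -
  obtain B where B: "B \<subseteq> S ` X" "independent B" "S ` X \<subseteq> span B"
    using maximal_independent_subset by blast
  have finB: "finite B"
    using independent_span_bound[OF assms(1) B(2)] B(1) assms(2) by blast
  define \<gamma> where "\<gamma> b = (\<lambda>x. if x \<in> X then representation B (S x) b else 0)" for b
  have "adjoint_map \<phi> = (\<Sum>b\<in>B. \<phi> b *\<^sub>R \<gamma> b)" if \<phi>: "\<phi> \<in> dual_space X N" for \<phi>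
  proof
    fix x
    have BX: "b \<in> X" if "b \<in> B" for b
      using that B(1) closed by auto
    have "\<phi> (S x) = (\<Sum>b\<in>B. \<phi> b * representation B (S x) b)" if x: "x \<in> X"
    proof -
      have "S x = (\<Sum>b\<in>B. representation B (S x) b *\<^sub>R b)"
        using real_vector.sum_representation_eq[OF B(2) _ finB order_refl, of "S x"] B(3) x by auto
      then have "\<phi> (S x) = \<phi> (\<Sum>b\<in>B. representation B (S x) b *\<^sub>R b)"
        by simp
      also have "\<dots> = (\<Sum>b\<in>B. \<phi> (representation B (S x) b *\<^sub>R b))"
        using BX subspace_base by (intro dual_space_sum[OF \<phi> _ finB]) (auto simp: subspace_scale)
      also have "\<dots> = (\<Sum>b\<in>B. \<phi> b * representation B (S x) b)"
        using BX by (intro sum.cong) (auto simp: dual_space_scale[OF \<phi>])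
      finally show ?thesis .
    qed
    then show "adjoint_map \<phi> x = (\<Sum>b\<in>B. \<phi> b *\<^sub>R \<gamma> b) x"
      by (simp add: adjoint_map_def \<gamma>_def sum_fun_apply)
  qed
  then have "adjoint_map ` dual_space X N \<subseteq> span (\<gamma> ` B)"
    by (auto intro!: span_sum span_scale intro: span_base)
  then show ?thesis
    unfolding finite_rank_on_def using finB by blast
qed

end


subsection \<open>The Lipschitz-free space\<close>

locale pointed_metric =
  fixes M :: "'a metric" and z :: 'a
  assumes base_point: "z \<in> mspace M"
begin

abbreviation "L \<equiv> Lip0 M z"
abbreviation "F \<equiv> lipschitz_free_space M z"

lemma Lip0I:
  assumes "0 \<le> B" "\<And>x y. \<lbrakk>x \<in> mspace M; y \<in> mspace M\<rbrakk> \<Longrightarrow> \<bar>f x - f y\<bar> \<le> B * mdist M x y"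
    and "f z = 0" "\<And>x. x \<notin> mspace M \<Longrightarrow> f x = 0"
  shows Lip0_memI: "f \<in> L" and lip_norm_le: "lip_norm M f \<le> B"
proof -
  show "f \<in> L"
    using assms by (auto simp: Lip0_def Lipschitz_continuous_map_def dist_real_def)
  show "lip_norm M f \<le> B"
    unfolding lip_norm_def using assms by (intro cInf_lower) (auto intro: bdd_belowI)
qed

lemma lip_norm_bounds:
  assumes "f \<in> L"
  shows lip_norm_nonneg: "0 \<le> lip_norm M f"
    and lip_norm_bound: "\<lbrakk>x \<in> mspace M; y \<in> mspace M\<rbrakk> \<Longrightarrow> \<bar>f x - f y\<bar> \<le> lip_norm M f * mdist M x y"
proof -
  let ?S = "{L. 0 \<le> L \<and> (\<forall>x\<in>mspace M. \<forall>y\<in>mspace M. \<bar>f x - f y\<bar> \<le> L * mdist M x y)}"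
  obtain B where "B > 0" "\<forall>x\<in>mspace M. \<forall>y\<in>mspace M. \<bar>f x - f y\<bar> \<le> B * mdist M x y"
    using assms by (auto simp: Lip0_def Lipschitz_continuous_map_pos dist_real_def)
  then have B: "B \<in> ?S"
    by simp
  then have ne: "?S \<noteq> {}"
    by blast
  then show "0 \<le> lip_norm M f"
    unfolding lip_norm_def by (rule cInf_greatest) auto
  assume x: "x \<in> mspace M" "y \<in> mspace M"
  show "\<bar>f x - f y\<bar> \<le> lip_norm M f * mdist M x y"
  proof (cases "mdist M x y = 0")
    case True
    then show ?thesis
      using x B by simp (metis Metric_space.mdist_zero[OF Metric_space_mspace_mdist] mult_zero_right order_refl)
  next
    case False
    then have pos: "0 < mdist M x y"
      using mdist_nonneg[of M x y] by linarith
    then have "\<bar>f x - f y\<bar> / mdist M x y \<le> lip_norm M f"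
      unfolding lip_norm_def using x
      by (intro cInf_greatest[OF ne]) (auto simp: pos_divide_le_eq)
    then show ?thesis
      using pos by (simp add: pos_divide_le_eq)
  qed
qed

lemma Lip0_base: "f \<in> L \<Longrightarrow> f z = 0"
  and Lip0_outside: "\<lbrakk>f \<in> L; x \<notin> mspace M\<rbrakk> \<Longrightarrow> f x = 0"
  by (auto simp: Lip0_def)

lemma Lip0_bound: "\<lbrakk>f \<in> L; x \<in> mspace M\<rbrakk> \<Longrightarrow> \<bar>f x\<bar> \<le> mdist M x z * lip_norm M f"
  using lip_norm_bound[of f x z] base_point Lip0_base[of f] by (simp add: mult.commute)

lemma subspace_Lip0: "subspace L"
proof (rule subspaceI)
  show "0 \<in> L"
    by (rule Lip0_memI[where B=0]) auto
next
  fix f g assume f: "f \<in> L" and g: "g \<in> L"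
  show "f + g \<in> L"
  proof (rule Lip0_memI[where B="lip_norm M f + lip_norm M g"])
    fix x y assume "x \<in> mspace M" "y \<in> mspace M"
    then show "\<bar>(f + g) x - (f + g) y\<bar> \<le> (lip_norm M f + lip_norm M g) * mdist M x y"
      using lip_norm_bound[OF f, of x y] lip_norm_bound[OF g, of x y] by (simp add: distrib_right)
  qed (use f g in \<open>auto simp: lip_norm_nonneg Lip0_base Lip0_outside\<close>)
next
  fix c f assume f: "f \<in> L"
  show "c *\<^sub>R f \<in> L"
  proof (rule Lip0_memI[where B="\<bar>c\<bar> * lip_norm M f"])
    fix x y assume "x \<in> mspace M" "y \<in> mspace M"
    then show "\<bar>(c *\<^sub>R f) x - (c *\<^sub>R f) y\<bar> \<le> \<bar>c\<bar> * lip_norm M f * mdist M x y"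
      using lip_norm_bound[OF f, of x y]
      by (simp add: abs_mult mult.assoc mult_left_mono flip: right_diff_distrib)
  qed (use f in \<open>auto simp: lip_norm_nonneg Lip0_base Lip0_outside\<close>)
qed

sublocale dual_pair L "lip_norm M"
  by unfold_locales (auto simp: subspace_Lip0 lip_norm_nonneg)

lemma evaluation_in_dual: "x \<in> mspace M \<Longrightarrow> evaluation M z x \<in> Lip0_dual M z"
  using Lip0_bound subspace_Lip0
  by (intro dual_spaceI[where B="mdist M x z"])
    (auto simp: evaluation_def subspace_add subspace_scale)

lemma span_evaluation_subset: "span (evaluation M z ` mspace M) \<subseteq> Lip0_dual M z"
  using evaluation_in_dual subspace_dual by (intro span_minimal) auto

lemma in_free_space:
  "\<mu> \<in> F \<longleftrightarrow> \<mu> \<in> Lip0_dual M z \<and>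
     (\<forall>\<epsilon>>0. \<exists>\<nu>\<in>span (evaluation M z ` mspace M). Lip0_dual_norm M z (\<mu> - \<nu>) < \<epsilon>)"
  unfolding lipschitz_free_space_def by (rule dual.in_closure[OF span_evaluation_subset])

lemma subspace_free_space: "subspace F"
  unfolding lipschitz_free_space_def by (rule dual.subspace_closure[OF subspace_span span_evaluation_subset])

lemma span_subset_free_space: "span (evaluation M z ` mspace M) \<subseteq> F"
proof
  fix \<nu> assume \<nu>: "\<nu> \<in> span (evaluation M z ` mspace M)"
  have "Lip0_dual_norm M z (\<nu> - \<nu>) = 0"
    unfolding diff_self by (rule dual.zero)
  then show "\<nu> \<in> F"
    unfolding in_free_space using subsetD[OF span_evaluation_subset \<nu>]
    by (intro conjI allI impI bexI[OF _ \<nu>]) simp_all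
qed

lemma free_space_subset: "F \<subseteq> Lip0_dual M z"
  by (auto simp: in_free_space)

lemma free_space_closed:
  assumes "\<mu> \<in> Lip0_dual M z" "\<And>\<epsilon>. 0 < \<epsilon> \<Longrightarrow> \<exists>\<nu>\<in>F. Lip0_dual_norm M z (\<mu> - \<nu>) < \<epsilon>"
  shows "\<mu> \<in> F"
  unfolding in_free_space
proof (intro conjI allI impI)
  fix \<epsilon> :: real assume "0 < \<epsilon>"
  then obtain \<nu> where \<nu>: "\<nu> \<in> F" "Lip0_dual_norm M z (\<mu> - \<nu>) < \<epsilon>/2"
    using assms(2) half_gt_zero by blast
  then obtain \<nu>' where \<nu>': "\<nu>' \<in> span (evaluation M z ` mspace M)" "Lip0_dual_norm M z (\<nu> - \<nu>') < \<epsilon>/2"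
    using \<open>0 < \<epsilon>\<close> half_gt_zero unfolding in_free_space by blast
  have "Lip0_dual_norm M z (\<mu> - \<nu>') \<le> Lip0_dual_norm M z (\<mu> - \<nu>) + Lip0_dual_norm M z (\<nu> - \<nu>')"
    using assms(1) \<nu>(1) \<nu>'(1) free_space_subset span_evaluation_subset by (intro dual.diff_triangle) auto
  then show "\<exists>\<nu>'\<in>span (evaluation M z ` mspace M). Lip0_dual_norm M z (\<mu> - \<nu>') < \<epsilon>"
    using \<nu>(2) \<nu>' by (intro bexI[of _ \<nu>']) auto
qed (rule assms(1))

sublocale free: normed_subspace F "Lip0_dual_norm M z"
  by (rule dual.normed_subspace_subset[OF subspace_free_space free_space_subset])

text \<open>The adjoint of an arbitrary contraction of the Lipschitz space may leave the free space,
  hence the condition on point evaluations. Linearity extends it to their span, and contractivity to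
  the closure.\<close>

lemma adjoint_map_free_space:
  assumes "linear_contraction L (lip_norm M) S"
    and eval: "\<And>x. x \<in> mspace M \<Longrightarrow> linear_contraction.adjoint_map L S (evaluation M z x) \<in> F"
  shows "bounded_linear_on F (Lip0_dual_norm M z) F (Lip0_dual_norm M z) (linear_contraction.adjoint_map L S)"
proof -
  interpret S: linear_contraction L "lip_norm M" S
    by (rule assms(1))
  let ?T = "S.adjoint_map"
  have span: "?T \<nu> \<in> F" if "\<nu> \<in> span (evaluation M z ` mspace M)" for \<nu>
    using that
  proof (induction rule: span_induct_alt)
    case base
    have "?T 0 = 0"
      using S.adjoint_map_scale[of 0 0] by simp
    then show ?case
      using subspace_0[OF subspace_free_space] by metis
  next
    case (step c \<delta> \<nu>)
    then have "?T \<delta> \<in> F"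
      using eval by blast
    then have "c *\<^sub>R ?T \<delta> + ?T \<nu> \<in> F"
      using step subspace_free_space by (intro subspace_add subspace_scale)
    then show ?case
      unfolding S.adjoint_map_add S.adjoint_map_scale .
  qed
  have "?T \<mu> \<in> F" if \<mu>: "\<mu> \<in> F" for \<mu>
  proof (rule free_space_closed)
    show "?T \<mu> \<in> Lip0_dual M z"
      using S.adjoint_map_closed \<mu> free_space_subset by blast
    fix \<epsilon> :: real assume "0 < \<epsilon>"
    then obtain \<nu> where \<nu>: "\<nu> \<in> span (evaluation M z ` mspace M)" "Lip0_dual_norm M z (\<mu> - \<nu>) < \<epsilon>"
      using \<mu> unfolding in_free_space by blast
    have "\<mu> - \<nu> \<in> Lip0_dual M z"
      using \<mu> \<nu>(1) free_space_subset span_evaluation_subset subspace_dual by (auto intro!: subspace_diff)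
    then have "Lip0_dual_norm M z (?T (\<mu> - \<nu>)) < \<epsilon>"
      using S.adjoint_map_contracts \<nu>(2) by fastforce
    moreover have "?T (\<mu> - \<nu>) = ?T \<mu> - ?T \<nu>"
      by (auto simp: S.adjoint_map_def fun_eq_iff)
    ultimately show "\<exists>\<nu>\<in>F. Lip0_dual_norm M z (?T \<mu> - \<nu>) < \<epsilon>"
      using span[OF \<nu>(1)] by auto
  qed
  moreover have "\<exists>B. \<forall>\<mu>\<in>F. Lip0_dual_norm M z (?T \<mu>) \<le> B * Lip0_dual_norm M z \<mu>"
    using S.adjoint_map_contracts free_space_subset by (intro exI[of _ 1]) auto
  ultimately show ?thesis
    unfolding bounded_linear_on_def by (auto simp: S.adjoint_map_add S.adjoint_map_scale)
qed

text \<open>The last condition is uniform in \<open>f\<close>, so it bounds the dual norm of the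
  difference between a point evaluation and its image under the adjoint. Point evaluations have
  dense span, and the criterion for spanning sets applies.\<close>

lemma metric_approximation_property_free_space:
  assumes "\<And>\<epsilon>. 0 < \<epsilon> \<Longrightarrow> \<exists>S C. linear_contraction L (lip_norm M) S \<and> finite C \<and> S ` L \<subseteq> span C \<and>
      (\<forall>x\<in>mspace M. linear_contraction.adjoint_map L S (evaluation M z x) \<in> F) \<and>
      (\<forall>x\<in>mspace M. \<forall>f\<in>L. \<bar>S f x - f x\<bar> \<le> \<epsilon> * lip_norm M f)"
  shows "metric_approximation_property F (Lip0_dual_norm M z)"
proof (rule free.metric_approximation_property_dense)
  show "evaluation M z ` mspace M \<subseteq> F"
    using span_subset_free_space span_superset by blast
  \<comment> \<open>The closure is taken inside \<open>F\<close>, whereas \<open>F\<close> is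
    defined by a closure in the whole dual; both amount to the same norm condition.\<close>
  show "F \<subseteq> norm_topology F (Lip0_dual_norm M z) closure_of span (evaluation M z ` mspace M)"
    unfolding free.in_closure[OF span_subset_free_space] subset_iff in_free_space by blast
  fix \<epsilon> :: real assume "0 < \<epsilon>"
  then obtain S C where S: "linear_contraction L (lip_norm M) S" "finite C" "S ` L \<subseteq> span C"
      "\<And>x. x \<in> mspace M \<Longrightarrow> linear_contraction.adjoint_map L S (evaluation M z x) \<in> F"
      "\<And>x f. \<lbrakk>x \<in> mspace M; f \<in> L\<rbrakk> \<Longrightarrow> \<bar>S f x - f x\<bar> \<le> \<epsilon> * lip_norm M f"
    using assms by meson
  interpret S: linear_contraction L "lip_norm M" S
    by (rule S(1))
  let ?T = "S.adjoint_map"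
  have "finite_rank_on F ?T"
    using S.adjoint_map_finite_rank[OF S(2,3)] free_space_subset unfolding finite_rank_on_def by blast
  moreover have "Lip0_dual_norm M z (?T (evaluation M z x) - evaluation M z x) \<le> \<epsilon>" if "x \<in> mspace M" for x
    using S(5)[OF that] \<open>0 < \<epsilon>\<close>
    by (intro dual_norm_le) (auto simp: S.adjoint_map_def evaluation_def S.closed)
  ultimately show "\<exists>T. bounded_linear_on F (Lip0_dual_norm M z) F (Lip0_dual_norm M z) T \<and> finite_rank_on F T \<and>
      (\<forall>\<mu>\<in>F. Lip0_dual_norm M z (T \<mu>) \<le> Lip0_dual_norm M z \<mu>) \<and>
      (\<forall>\<delta>\<in>evaluation M z ` mspace M. Lip0_dual_norm M z (T \<delta> - \<delta>) \<le> \<epsilon>)"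
    using adjoint_map_free_space[OF S(1,4)] S.adjoint_map_contracts free_space_subset
    by (intro exI[of _ ?T]) auto
qed

end


subsection \<open>Averaging over isometric actions\<close>

text \<open>Continuity of the action is phrased through distances to fixed points, so that no
  topology on the type of points is involved. Choosing the fixed point on the orbit recovers
  continuity of the orbit maps.\<close>

locale averaged_action = pointed_metric M z + mean_functional G \<Lambda>
  for M :: "'a metric" and z :: 'a and G :: "'g::metric_space set" and \<Lambda> :: "('g \<Rightarrow> real) \<Rightarrow> real" +
  fixes act :: "'g \<Rightarrow> 'a \<Rightarrow> 'a"
  assumes compact_G: "compact G"
    and act_closed: "\<lbrakk>g \<in> G; x \<in> mspace M\<rbrakk> \<Longrightarrow> act g x \<in> mspace M"
    and act_isometry: "\<lbrakk>g \<in> G; x \<in> mspace M; y \<in> mspace M\<rbrakk> \<Longrightarrow> mdist M (act g x) (act g y) = mdist M x y"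
    and continuous_act: "\<lbrakk>x \<in> mspace M; y \<in> mspace M\<rbrakk> \<Longrightarrow> continuous_on G (\<lambda>g. mdist M (act g x) y)"
begin

definition average :: "('a \<Rightarrow> real) \<Rightarrow> 'a \<Rightarrow> real" where
  "average f x = (if x \<in> mspace M then \<Lambda> (\<lambda>g. f (act g x) - f (act g z)) else 0)"

lemma mdist_self: "x \<in> mspace M \<Longrightarrow> mdist M x x = 0"
  by (rule Metric_space.mdist_zero[OF Metric_space_mspace_mdist])

lemma continuous_orbit:
  assumes f: "f \<in> L" and x: "x \<in> mspace M"
  shows "continuous_on G (\<lambda>g. f (act g x))"
  unfolding continuous_on_def
proof
  fix h assume h: "h \<in> G"
  have "((\<lambda>g. mdist M (act g x) (act h x)) \<longlongrightarrow> mdist M (act h x) (act h x)) (at h within G)"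
    using continuous_act[OF x act_closed[OF h x]] h unfolding continuous_on_def by blast
  then have "((\<lambda>g. lip_norm M f * mdist M (act g x) (act h x)) \<longlongrightarrow> lip_norm M f * 0) (at h within G)"
    using mdist_self[OF act_closed[OF h x]] by (intro tendsto_mult_left) simp
  then have 0: "((\<lambda>g. lip_norm M f * mdist M (act g x) (act h x)) \<longlongrightarrow> 0) (at h within G)"
    by simp
  have "((\<lambda>g. f (act g x) - f (act h x)) \<longlongrightarrow> 0) (at h within G)"
  proof (rule Lim_null_comparison[OF _ 0])
    show "\<forall>\<^sub>F g in at h within G. norm (f (act g x) - f (act h x)) \<le> lip_norm M f * mdist M (act g x) (act h x)"
      using lip_norm_bound[OF f] act_closed x h by (auto simp: eventually_at_filter)
  qed
  then show "((\<lambda>g. f (act g x)) \<longlongrightarrow> f (act h x)) (at h within G)"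
    by (rule LIM_zero_cancel)
qed

lemma continuous_increment:
  "\<lbrakk>f \<in> L; x \<in> mspace M; y \<in> mspace M\<rbrakk> \<Longrightarrow> continuous_on G (\<lambda>g. f (act g x) - f (act g y))"
  by (intro continuous_on_diff continuous_orbit)

lemma average_diff:
  assumes "f \<in> L" "x \<in> mspace M" "y \<in> mspace M"
  shows "average f x - average f y = \<Lambda> (\<lambda>g. f (act g x) - f (act g y))"
  using diff[OF continuous_increment continuous_increment, of f x z f y z] assms base_point
  by (simp add: average_def)

lemma average_lipschitz:
  assumes f: "f \<in> L" and xy: "x \<in> mspace M" "y \<in> mspace M"
  shows "\<bar>average f x - average f y\<bar> \<le> lip_norm M f * mdist M x y"
proof -
  have "\<bar>\<Lambda> (\<lambda>g. f (act g x) - f (act g y))\<bar> \<le> \<Lambda> (\<lambda>_. lip_norm M f * mdist M x y)"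
  proof (rule abs_le)
    fix g assume "g \<in> G"
    then show "\<bar>f (act g x) - f (act g y)\<bar> \<le> lip_norm M f * mdist M x y"
      using lip_norm_bound[OF f, of "act g x" "act g y"] act_closed act_isometry xy by simp
  qed (use assms in \<open>auto intro: continuous_increment\<close>)
  then show ?thesis
    using average_diff[OF assms] by simp
qed

lemma average_base: "average f z = 0"
  by (simp add: average_def)

sublocale average: linear_contraction L "lip_norm M" average
proof
  fix f assume f: "f \<in> L"
  show "average f \<in> L"
    using average_lipschitz[OF f] lip_norm_nonneg[OF f]
    by (intro Lip0_memI[where B="lip_norm M f"]) (auto simp: average_base, simp add: average_def)
  show "lip_norm M (average f) \<le> lip_norm M f"
    using average_lipschitz[OF f] lip_norm_nonneg[OF f]
    by (intro lip_norm_le) (auto simp: average_base, simp add: average_def)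
  show "average (c *\<^sub>R f) = c *\<^sub>R average f" for c
  proof
    fix x
    show "average (c *\<^sub>R f) x = (c *\<^sub>R average f) x"
      using scale[OF continuous_increment[OF f _ base_point], of x c]
      by (simp add: average_def right_diff_distrib)
  qed
  fix h assume h: "h \<in> L"
  show "average (f + h) = average f + average h"
  proof
    fix x
    show "average (f + h) x = (average f + average h) x"
      using add[OF continuous_increment[OF f _ base_point] continuous_increment[OF h _ base_point], of x x]
      by (simp add: average_def algebra_simps)
  qed
qed

text \<open>The image of the evaluation at \<open>x\<close> is the mean of the differences of the
  evaluations at \<open>act g x\<close> and \<open>act g z\<close>. For all \<open>f\<close> of norm
  at most 1 the integrands have increments bounded by the same \<open>w\<close>, so a single finite
  combination of evaluations approximates the mean uniformly in \<open>f\<close>, that is, in the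
  dual norm and not merely pointwise.\<close>

lemma adjoint_average_in_free_space:
  assumes x: "x \<in> mspace M"
  shows "average.adjoint_map (evaluation M z x) \<in> F"
proof -
  let ?\<mu> = "average.adjoint_map (evaluation M z x)"
  have "?\<mu> \<in> Lip0_dual M z"
    by (intro average.adjoint_map_closed evaluation_in_dual x)
  moreover have "\<exists>\<nu>\<in>span (evaluation M z ` mspace M). Lip0_dual_norm M z (?\<mu> - \<nu>) < \<epsilon>" if "0 < \<epsilon>" for \<epsilon>
  proof -
    define w where "w h g = mdist M (act g x) (act h x) + mdist M (act g z) (act h z)" for h g
    obtain I c where I: "finite I" "I \<subseteq> G" and approx:
      "\<And>u C. \<lbrakk>continuous_on G u; 0 \<le> C; \<And>g h. \<lbrakk>g \<in> G; h \<in> G\<rbrakk> \<Longrightarrow> \<bar>u g - u h\<bar> \<le> C * w g h\<rbrakk>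
        \<Longrightarrow> \<bar>\<Lambda> u - (\<Sum>i\<in>I. c i * u i)\<bar> \<le> C * (\<epsilon>/2)"
    proof (rule finite_approx[OF compact_G, of w "\<epsilon>/2"])
      show "continuous_on G (w g)" if "g \<in> G" for g
        unfolding w_def using x base_point that
        by (intro continuous_on_add continuous_act act_closed)
      show "w g g = 0" if "g \<in> G" for g
        using x base_point that by (simp add: w_def mdist_self act_closed)
    qed (use \<open>0 < \<epsilon>\<close> in auto)
    define \<nu> where "\<nu> = (\<Sum>i\<in>I. c i *\<^sub>R (evaluation M z (act i x) - evaluation M z (act i z)))"
    have "Lip0_dual_norm M z (?\<mu> - \<nu>) \<le> \<epsilon>/2"
    proof (rule dual_norm_le)
      fix f assume f: "f \<in> L"
      let ?u = "\<lambda>g. f (act g x) - f (act g z)"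
      have "\<bar>\<Lambda> ?u - (\<Sum>i\<in>I. c i * ?u i)\<bar> \<le> lip_norm M f * (\<epsilon>/2)"
      proof (rule approx)
        show "continuous_on G ?u"
          by (rule continuous_increment[OF f x base_point])
        show "0 \<le> lip_norm M f"
          by (rule lip_norm_nonneg[OF f])
        fix g h assume gh: "g \<in> G" "h \<in> G"
        have "\<bar>f (act g x) - f (act h x)\<bar> \<le> lip_norm M f * mdist M (act h x) (act g x)"
             "\<bar>f (act g z) - f (act h z)\<bar> \<le> lip_norm M f * mdist M (act h z) (act g z)"
          using lip_norm_bound[OF f] act_closed gh x base_point by (metis abs_minus_commute)+
        then show "\<bar>?u g - ?u h\<bar> \<le> lip_norm M f * w g h"
          unfolding w_def distrib_left by linarith
      qed
      then show "\<bar>(?\<mu> - \<nu>) f\<bar> \<le> \<epsilon>/2 * lip_norm M f"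
        using f x by (simp add: average.adjoint_map_def evaluation_def average.closed \<nu>_def
            sum_fun_apply average_def mult.commute)
    qed (use \<open>0 < \<epsilon>\<close> in simp)
    moreover have "\<nu> \<in> span (evaluation M z ` mspace M)"
      unfolding \<nu>_def using I(2) act_closed x base_point
      by (intro span_sum span_scale span_diff span_base) auto
    ultimately show ?thesis
      using \<open>0 < \<epsilon>\<close> by (intro bexI[of _ \<nu>]) auto
  qed
  ultimately show ?thesis
    unfolding in_free_space by blast
qed

text \<open>Since \<open>f z = 0\<close>, the error under the mean is the increment of
  \<open>f\<close> from \<open>x\<close> to \<open>act g x\<close> minus that from \<open>z\<close>
  to \<open>act g z\<close>; each is bounded by the displacement of its point.\<close>

lemma average_approx:
  assumes f: "f \<in> L" and x: "x \<in> mspace M"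
    and small: "\<Lambda> (\<lambda>g. mdist M (act g x) x + mdist M (act g z) z) \<le> \<epsilon>"
  shows "\<bar>average f x - f x\<bar> \<le> \<epsilon> * lip_norm M f"
proof -
  have cont: "continuous_on G (\<lambda>g. mdist M (act g x) x + mdist M (act g z) z)"
    using x base_point by (intro continuous_on_add continuous_act)
  have "average f x - f x = \<Lambda> (\<lambda>g. f (act g x) - f (act g z) - f x)"
    using diff[OF continuous_increment[OF f x base_point], of "\<lambda>_. f x"] x by (simp add: average_def)
  also have "\<bar>\<dots>\<bar> \<le> \<Lambda> (\<lambda>g. lip_norm M f * (mdist M (act g x) x + mdist M (act g z) z))"
  proof (rule abs_le)
    show "continuous_on G (\<lambda>g. f (act g x) - f (act g z) - f x)"
      by (intro continuous_on_diff[OF continuous_increment[OF f x base_point]] continuous_on_const)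
    show "continuous_on G (\<lambda>g. lip_norm M f * (mdist M (act g x) x + mdist M (act g z) z))"
      by (rule continuous_on_mult_left[OF cont])
    fix g assume g: "g \<in> G"
    have "\<bar>f (act g x) - f x\<bar> \<le> lip_norm M f * mdist M (act g x) x"
         "\<bar>f (act g z) - f z\<bar> \<le> lip_norm M f * mdist M (act g z) z"
      using act_closed g x base_point by (auto intro: lip_norm_bound[OF f])
    then show "\<bar>f (act g x) - f (act g z) - f x\<bar> \<le> lip_norm M f * (mdist M (act g x) x + mdist M (act g z) z)"
      unfolding distrib_left using Lip0_base[OF f] by linarith
  qed
  also have "\<dots> \<le> lip_norm M f * \<epsilon>"
    using small lip_norm_nonneg[OF f] by (simp add: scale[OF cont] mult_left_mono)
  finally show ?thesis
    by (simp add: mult.commute)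
qed

end


text \<open>A tent function \<open>\<phi>\<close> supported near the unit is raised by
  \<open>\<kappa>/2\<close> before the polynomial approximation, which places \<open>p\<close>
  between \<open>\<phi>\<close> and \<open>\<phi> + \<kappa>\<close>; so \<open>p\<close> is
  nonnegative and has at least the mean of \<open>\<phi>\<close>. The part \<open>\<phi>\<close> of
  the weight sees only \<open>w \<le> \<epsilon>\<close>, the excess sees \<open>w \<le> W\<close>,
  and each contributes at most \<open>\<epsilon>\<close>. The weight is chosen before
  \<open>w\<close>, so it serves all points of the sphere.\<close>

lemma concentrated_polynomial:
  fixes G :: "'a::euclidean_space set"
  assumes "compact_group G mul e iv" "0 < \<delta>" "0 < \<epsilon>"
  obtains p where "real_polynomial_function p" "\<And>g. g \<in> G \<Longrightarrow> 0 \<le> p g"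
    "0 < compact_group.mean G mul e p"
    "\<And>w. \<lbrakk>continuous_on G w; \<And>g. g \<in> G \<Longrightarrow> w g \<le> W; \<And>g. \<lbrakk>g \<in> G; dist g e < \<delta>\<rbrakk> \<Longrightarrow> w g \<le> \<epsilon>\<rbrakk>
      \<Longrightarrow> compact_group.mean G mul e (\<lambda>g. p g * w g) / compact_group.mean G mul e p \<le> 2 * \<epsilon>"
proof -
  interpret compact_group G mul e iv
    by (rule assms(1))
  define \<phi> where "\<phi> g = max 0 (1 - dist g e / \<delta>)" for g
  have cont_\<phi>: "continuous_on G \<phi>"
    unfolding \<phi>_def by (intro continuous_intros) (use \<open>0 < \<delta>\<close> in auto)
  have "0 < mean \<phi>"
    by (rule mean_pos[OF cont_\<phi> _ unit_closed]) (auto simp: \<phi>_def)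
  \<comment> \<open>Chosen so that the excess contributes at most
    \<open>\<epsilon> * mean \<phi>\<close>. The denominator is positive for every real
    \<open>W\<close>.\<close>
  define \<kappa> where "\<kappa> = \<epsilon> * mean \<phi> / (\<bar>W\<bar> + 1)"
  have "0 < \<kappa>"
    using \<open>0 < mean \<phi>\<close> \<open>0 < \<epsilon>\<close> by (simp add: \<kappa>_def)
  have "continuous_on G (\<lambda>g. \<phi> g + \<kappa>/2)"
    using cont_\<phi> by (intro continuous_intros)
  then obtain p where p: "real_polynomial_function p" "\<And>g. g \<in> G \<Longrightarrow> \<bar>\<phi> g + \<kappa>/2 - p g\<bar> < \<kappa>/2"
    using Stone_Weierstrass_real_polynomial_function[OF compact, of "\<lambda>g. \<phi> g + \<kappa>/2" "\<kappa>/2"] \<open>0 < \<kappa>\<close>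
    by auto
  have cont_p: "continuous_on G p"
    using p(1) by (simp add: continuous_on_polymonial_function flip: real_polynomial_function_eq)
  have between: "\<phi> g \<le> p g" "p g \<le> \<phi> g + \<kappa>" if "g \<in> G" for g
    using p(2)[OF that] by linarith+
  have \<phi>_nonneg: "0 \<le> \<phi> g" for g
    by (simp add: \<phi>_def)
  have "mean \<phi> \<le> mean p"
    by (rule mono[OF cont_\<phi> cont_p between(1)])
  show thesis
  proof
    show "real_polynomial_function p"
      by (rule p(1))
    show "0 \<le> p g" if "g \<in> G" for g
      using between(1)[OF that] \<phi>_nonneg[of g] by linarith
    show "0 < mean p"
      using \<open>0 < mean \<phi>\<close> \<open>mean \<phi> \<le> mean p\<close> by linarith
    fix w assume w: "continuous_on G w" "\<And>g. g \<in> G \<Longrightarrow> w g \<le> W" "\<And>g. \<lbrakk>g \<in> G; dist g e < \<delta>\<rbrakk> \<Longrightarrow> w g \<le> \<epsilon>"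
    have "p g * w g \<le> \<epsilon> * \<phi> g + \<kappa> * \<bar>W\<bar>" if "g \<in> G" for g
    proof -
      have "\<phi> g * w g \<le> \<phi> g * \<epsilon>"
      proof (cases "dist g e < \<delta>")
        case True
        then show ?thesis
          using w(3)[OF that] \<phi>_nonneg by (intro mult_left_mono)
      next
        case False
        then have "\<phi> g = 0"
          using \<open>0 < \<delta>\<close> by (simp add: \<phi>_def)
        then show ?thesis
          by simp
      qed
      moreover have "(p g - \<phi> g) * w g \<le> \<kappa> * \<bar>W\<bar>"
      proof -
        have "(p g - \<phi> g) * w g \<le> (p g - \<phi> g) * \<bar>W\<bar>"
          using between(1)[OF that] w(2)[OF that] by (intro mult_left_mono) auto
        also have "\<dots> \<le> \<kappa> * \<bar>W\<bar>"
          using between(2)[OF that] by (intro mult_right_mono) auto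
        finally show ?thesis .
      qed
      ultimately show ?thesis
        by (simp add: algebra_simps)
    qed
    then have "mean (\<lambda>g. p g * w g) \<le> mean (\<lambda>g. \<epsilon> * \<phi> g + \<kappa> * \<bar>W\<bar>)"
      using cont_p cont_\<phi> w(1) by (intro mono continuous_intros)
    also have "\<dots> = \<epsilon> * mean \<phi> + \<kappa> * \<bar>W\<bar>"
      using cont_\<phi> by (simp add: add scale continuous_on_mult_left)
    also have "\<kappa> * \<bar>W\<bar> \<le> \<epsilon> * mean \<phi>"
    proof -
      have "\<kappa> * \<bar>W\<bar> \<le> \<kappa> * (\<bar>W\<bar> + 1)"
        using \<open>0 < \<kappa>\<close> by simp
      also have "\<dots> = \<epsilon> * mean \<phi>"
        by (simp add: \<kappa>_def)
      finally show ?thesis .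
    qed
    finally have "mean (\<lambda>g. p g * w g) \<le> 2 * \<epsilon> * mean \<phi>"
      by simp
    also have "\<dots> \<le> 2 * \<epsilon> * mean p"
      using \<open>mean \<phi> \<le> mean p\<close> \<open>0 < \<epsilon>\<close> by simp
    finally show "mean (\<lambda>g. p g * w g) / mean p \<le> 2 * \<epsilon>"
      using \<open>0 < mean p\<close> by (simp add: pos_divide_le_eq)
  qed
qed

subsection \<open>The rotation group\<close>

abbreviation rotations :: "(real^'n^'n) set" where
  "rotations \<equiv> Collect rotation_matrix"

lemma continuous_matrix_mult:
  "continuous_on UNIV (\<lambda>(A, B). A ** B :: real^'n^'n)"
  unfolding matrix_matrix_mult_def case_prod_unfold
  by (intro continuous_intros)

text \<open>Rotations are cut out by polynomial equations in the entries, and their rows are unit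
  vectors.\<close>

lemma compact_rotations: "compact (rotations :: (real^'n^'n) set)"
proof -
  have "continuous_on UNIV (\<lambda>A::real^'n^'n. transpose A ** A)" "continuous_on UNIV (\<lambda>A::real^'n^'n. A ** transpose A)"
    unfolding matrix_matrix_mult_def transpose_def by (intro continuous_intros)+
  moreover have "continuous_on UNIV (\<lambda>A::real^'n^'n. det A)"
    unfolding det_def by (intro continuous_intros)
  ultimately have "closed (rotations :: (real^'n^'n) set)"
    unfolding rotation_matrix_def orthogonal_matrix_def
    by (intro closed_Collect_conj closed_Collect_eq continuous_on_const)
  moreover have "norm A \<le> CARD('n)" if "rotation_matrix A" for A :: "real^'n^'n"
  proof -
    have "norm (A $ i) = 1" for i
      using that by (simp add: rotation_matrix_def orthogonal_matrix_orthonormal_rows row_def)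
    then show ?thesis
      using L2_set_le_sum[of UNIV "\<lambda>i. norm (A $ i)"] by (simp add: norm_vec_def)
  qed
  then have "bounded (rotations :: (real^'n^'n) set)"
    unfolding bounded_iff by blast
  ultimately show ?thesis
    by (simp add: compact_eq_bounded_closed)
qed

interpretation rotation: compact_group rotations "(**)" "mat 1" transpose
proof
  show "continuous_on (rotations \<times> rotations) (\<lambda>(A, B). A ** B :: real^'n^'n)"
    using continuous_matrix_mult by (rule continuous_on_subset) simp
  show "A ** B \<in> rotations" if "A \<in> rotations" "B \<in> rotations" for A B :: "real^'n^'n"
    using that by (simp add: rotation_matrix_def orthogonal_matrix_mul det_mul)
qed (auto simp: compact_rotations rotation_matrix_def orthogonal_matrix_def matrix_mul_assoc)

text \<open>Dimension at least 2 enters here: on the line the only rotation is the identity, while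
  the unit sphere has two points.\<close>

lemma rotation_transitive:
  fixes x y :: "real^'n"
  assumes "CARD('n) \<ge> 2" "x \<in> sphere 0 1" "y \<in> sphere 0 1"
  obtains A where "rotation_matrix A" "A *v x = y"
proof -
  obtain f where f: "orthogonal_transformation f" "det (matrix f) = 1" "f x = y"
    using rotation_exists_1[of x y] assms by auto
  then have "rotation_matrix (matrix f)" "matrix f *v x = y"
    by (auto simp: rotation_matrix_def orthogonal_transformation_matrix matrix_works linear_iff
        orthogonal_transformation_linear)
  then show thesis
    by (rule that)
qed

lemma rotation_sphere: "\<lbrakk>rotation_matrix A; x \<in> sphere 0 1\<rbrakk> \<Longrightarrow> A *v x \<in> sphere 0 1"
  for x :: "real^'n"
  using orthogonal_transformation_norm[of "(*v) A" x]
  by (simp add: rotation_matrix_def orthogonal_transformation_matrix)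

section \<open>Separation of variables for polynomials of a matrix product\<close>

lemma sum_list_product:
  fixes f :: "'a \<Rightarrow> 'c::semiring_0"
  shows "(\<Sum>x\<leftarrow>xs. f x) * (\<Sum>y\<leftarrow>ys. g y) = (\<Sum>(x, y)\<leftarrow>List.product xs ys. f x * g y)"
  by (induction xs) (simp_all add: distrib_right o_def sum_list_const_mult)

text \<open>Translates of a polynomial span a finite-dimensional space.\<close>

lemma real_polynomial_function_matrix_mult:
  fixes p :: "real^'n^'n \<Rightarrow> real"
  assumes "real_polynomial_function p"
  shows "\<exists>(n::nat) a b. (\<forall>i<n. continuous_on UNIV (a i)) \<and>
    (\<forall>A B :: real^'n^'n. p (A ** B) = (\<Sum>i<n. a i A * b i B))"
proof -
  \<comment> \<open>Separated sums are kept as lists of factor pairs: sums become concatenations and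
    products become product lists. Continuity is recorded for the left factors, the ones that will
    be integrated.\<close>
  have "\<exists>ps :: ((real^'n^'n \<Rightarrow> real) \<times> (real^'n^'n \<Rightarrow> real)) list.
      (\<forall>(a, b)\<in>set ps. continuous_on UNIV a) \<and> (\<forall>A B. p (A ** B) = (\<Sum>(a, b)\<leftarrow>ps. a A * b B))"
    using assms
  proof (induction rule: real_polynomial_function.induct)
    case (linear f)
    define E :: "'n \<Rightarrow> 'n \<Rightarrow> real^'n^'n" where "E i j = axis i (axis j 1)" for i j
    obtain xs :: "('n \<times> 'n \<times> 'n) list" where xs: "set xs = UNIV" "distinct xs"
      using finite_distinct_list[OF finite_class.finite_UNIV] by blast
    \<comment> \<open>A linear \<open>f\<close> is determined by its values on the matrix units
      \<open>E i j\<close>, and each entry of \<open>A ** B\<close> is a sum over \<open>k\<close>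
      of products of entries.\<close>
    define ps where "ps = map (\<lambda>(i, j, k). (\<lambda>A::real^'n^'n. A $ i $ k, \<lambda>B::real^'n^'n. B $ k $ j * f (E i j))) xs"
    have lin: "linear f"
      using linear by (rule bounded_linear.linear)
    have E: "r * E i j $ k $ l = (if k = i then if l = j then r else 0 else 0)" for r i j k l
      by (simp add: E_def axis_def)
    have expand: "C = (\<Sum>i\<in>UNIV. \<Sum>j\<in>UNIV. (C $ i $ j) *\<^sub>R E i j)" for C :: "real^'n^'n"
    proof -
      have "(\<Sum>j\<in>UNIV. (C $ i $ j) * E i j $ k $ l) = (if k = i then C $ i $ l else 0)" for i k l
        unfolding E by simp
      then show ?thesis
        by (simp add: vec_eq_iff)
    qed
    have f_expand: "f C = (\<Sum>i\<in>UNIV. \<Sum>j\<in>UNIV. C $ i $ j * f (E i j))" for C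
    proof -
      have "f C = f (\<Sum>i\<in>UNIV. \<Sum>j\<in>UNIV. (C $ i $ j) *\<^sub>R E i j)"
        by (rule arg_cong[OF expand])
      then show ?thesis
        by (simp add: linear_sum[OF lin] linear_cmul[OF lin])
    qed
    have "f (A ** B) = (\<Sum>(a, b)\<leftarrow>ps. a A * b B)" for A B
    proof -
      have "f (A ** B) = (\<Sum>i\<in>UNIV. \<Sum>j\<in>UNIV. (A ** B) $ i $ j * f (E i j))"
        by (rule f_expand)
      also have "\<dots> = (\<Sum>i\<in>UNIV. \<Sum>j\<in>UNIV. \<Sum>k\<in>UNIV. A $ i $ k * (B $ k $ j * f (E i j)))"
        by (simp add: matrix_matrix_mult_def sum_distrib_right mult.assoc)
      also have "\<dots> = (\<Sum>(i, j, k)\<in>UNIV. A $ i $ k * (B $ k $ j * f (E i j)))"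
        by (simp add: sum.cartesian_product)
      also have "\<dots> = (\<Sum>(i, j, k)\<leftarrow>xs. A $ i $ k * (B $ k $ j * f (E i j)))"
        using sum.distinct_set_conv_list[OF xs(2)] xs(1) by simp
      also have "\<dots> = (\<Sum>(a, b)\<leftarrow>ps. a A * b B)"
        unfolding ps_def by (simp add: o_def case_prod_unfold)
      finally show ?thesis .
    qed
    moreover have "\<forall>(a, b)\<in>set ps. continuous_on UNIV a"
      by (auto simp: ps_def intro!: continuous_intros)
    ultimately show ?case
      by blast
  next
    case (const c)
    show ?case
      by (rule exI[of _ "[(\<lambda>_. c, \<lambda>_. 1)]"]) simp
  next
    case (add f g)
    then obtain ps qs :: "((real^'n^'n \<Rightarrow> real) \<times> (real^'n^'n \<Rightarrow> real)) list" where
      "\<forall>(a, b)\<in>set ps. continuous_on UNIV a" "\<forall>A B. f (A ** B) = (\<Sum>(a, b)\<leftarrow>ps. a A * b B)"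
      "\<forall>(a, b)\<in>set qs. continuous_on UNIV a" "\<forall>A B. g (A ** B) = (\<Sum>(a, b)\<leftarrow>qs. a A * b B)"
      by blast
    then show ?case
      by (intro exI[of _ "ps @ qs"]) auto
  next
    case (mult f g)
    then obtain ps qs :: "((real^'n^'n \<Rightarrow> real) \<times> (real^'n^'n \<Rightarrow> real)) list" where
      ps: "\<forall>(a, b)\<in>set ps. continuous_on UNIV a" "\<forall>A B. f (A ** B) = (\<Sum>(a, b)\<leftarrow>ps. a A * b B)" and
      qs: "\<forall>(a, b)\<in>set qs. continuous_on UNIV a" "\<forall>A B. g (A ** B) = (\<Sum>(a, b)\<leftarrow>qs. a A * b B)"
      by blast
    define rs where "rs = map (\<lambda>((a, b), (a', b')). (\<lambda>A. a A * a' A, \<lambda>B. b B * b' B)) (List.product ps qs)"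
    have *: "(\<Sum>(a, b)\<leftarrow>ps. a A * b B) * (\<Sum>(a, b)\<leftarrow>qs. a A * b B)
        = (\<Sum>(a, b)\<leftarrow>map (\<lambda>((a, b), (a', b')). (\<lambda>A. a A * a' A, \<lambda>B. b B * b' B)) (List.product ps qs). a A * b B)" for A B
      unfolding sum_list_product map_map
      by (intro arg_cong[where f=sum_list] map_cong refl) (simp add: case_prod_unfold mult_ac)
    show ?case
    proof (intro exI[of _ rs] conjI allI)
      show "\<forall>(a, b)\<in>set rs. continuous_on UNIV a"
        using ps(1) qs(1) by (fastforce simp: rs_def intro!: continuous_on_mult)
      show "f (A ** B) * g (A ** B) = (\<Sum>(a, b)\<leftarrow>rs. a A * b B)" for A B
        using * ps(2) qs(2) by (simp add: rs_def)
    qed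
  qed
  then obtain ps where ps: "\<And>a b. (a, b) \<in> set ps \<Longrightarrow> continuous_on UNIV a"
      "\<And>A B :: real^'n^'n. p (A ** B) = (\<Sum>(a, b)\<leftarrow>ps. a A * b B)"
    by fast
  show ?thesis
  proof (rule exI[of _ "length ps"], rule exI[of _ "\<lambda>i. fst (ps ! i)"],
      rule exI[of _ "\<lambda>i. snd (ps ! i)"], intro conjI allI impI)
    show "continuous_on UNIV (fst (ps ! i))" if "i < length ps" for i
      using ps(1)[of "fst (ps ! i)" "snd (ps ! i)"] that by simp
    show "p (A ** B) = (\<Sum>i<length ps. fst (ps ! i) A * snd (ps ! i) B)" for A B :: "real^'n^'n"
      by (simp add: ps(2) sum_list_sum_nth case_prod_unfold atLeast0LessThan)
  qed
qed

text \<open>A metric is jointly continuous for its own topology. Compatibility turns this into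
  continuity in the Euclidean sense, on which all compactness arguments for \<open>D\<close>
  rest.\<close>

lemma continuous_on_mdist:
  fixes M :: "'a::topological_space metric"
  assumes "mtopology_of M = top_of_set S"
  shows "continuous_on (S \<times> S) (\<lambda>(x, y). mdist M x y)"
proof -
  have "prod_topology (top_of_set S) (top_of_set S) = top_of_set (S \<times> S)"
    by (simp flip: subtopology_Times)
  then show ?thesis
    using continuous_map_metric[of M] assms by simp
qed


theorem mainTheorem5:
  fixes D :: "(real ^ 'n) metric" and z :: "real ^ 'n"
  assumes "CARD('n) \<ge> 2"
    and "mspace D = sphere 0 1"
    and "mtopology_of D = top_of_set (sphere 0 1)"
    and "\<And>R x y. rotation_matrix R \<Longrightarrow> x \<in> sphere 0 1 \<Longrightarrow> y \<in> sphere 0 1 \<Longrightarrow>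
           mdist D (R *v x) (R *v y) = mdist D x y"
    and "z \<in> sphere 0 1"
  shows "metric_approximation_property (lipschitz_free_space D z) (Lip0_dual_norm D z)"
proof -
  define S :: "(real^'n) set" where "S = sphere 0 1"
  note D = assms(2-5)[folded S_def]
  have rot_S: "A *v x \<in> S" if "rotation_matrix A" "x \<in> S" for A and x :: "real^'n"
    using rotation_sphere that unfolding S_def by blast
  interpret pointed_metric D z
    using D by unfold_locales simp
  let ?G = "rotations :: (real^'n^'n) set"
  let ?m = "rotation.mean :: (real^'n^'n \<Rightarrow> real) \<Rightarrow> real"
  have cont_D: "continuous_on (S \<times> S) (\<lambda>(x, y). mdist D x y)"
    by (rule continuous_on_mdist[OF D(2)])
  have cont_act: "continuous_on UNIV (\<lambda>(A, x). A *v x :: real^'n)"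
    unfolding matrix_vector_mult_def case_prod_unfold by (intro continuous_intros)
  have cont_orbit: "continuous_on ?G (\<lambda>A. mdist D (A *v x) y)" if "x \<in> S" "y \<in> S" for x y
  proof -
    have "continuous_on ?G (\<lambda>A. (A *v x, y))"
      unfolding matrix_vector_mult_def by (intro continuous_intros)
    then show ?thesis
      using continuous_on_compose2[OF cont_D, of ?G "\<lambda>A. (A *v x, y)"] rot_S that by auto
  qed
  define W where "W = (\<lambda>(A, x). mdist D (A *v x) x)"
  have cont_W: "continuous_on (?G \<times> S) W"
  proof -
    have "continuous_on (?G \<times> S) (\<lambda>q. (case q of (A, x) \<Rightarrow> A *v x, snd q))"
      by (intro continuous_on_Pair continuous_on_subset[OF cont_act] continuous_intros) auto
    then show ?thesis
      using continuous_on_compose2[OF cont_D, of "?G \<times> S" "\<lambda>q. (case q of (A, x) \<Rightarrow> A *v x, snd q)"] rot_S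
      by (force simp: W_def case_prod_unfold)
  qed
  have compact_GS: "compact (?G \<times> S)"
    unfolding S_def by (intro compact_Times compact_rotations compact_sphere)
  have "bounded (W ` (?G \<times> S))"
    by (intro compact_imp_bounded compact_continuous_image cont_W compact_GS)
  then obtain B where B: "\<And>A x. \<lbrakk>A \<in> ?G; x \<in> S\<rbrakk> \<Longrightarrow> mdist D (A *v x) x \<le> B"
    unfolding bounded_iff W_def by fastforce
  have unif_W: "uniformly_continuous_on (?G \<times> S) W"
    by (rule compact_uniformly_continuous[OF cont_W compact_GS])
  show ?thesis
  proof (rule metric_approximation_property_free_space)
    fix \<epsilon> :: real assume "0 < \<epsilon>"
    \<comment> \<open>The displacements of \<open>x\<close> and of \<open>z\<close> are each at most
      \<open>\<epsilon>/4\<close> near the identity. Their sum is at most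
      \<open>\<epsilon>/2\<close>, and concentration doubles this to \<open>\<epsilon>\<close>;
      likewise \<open>2 * B\<close> below bounds the sum of the two displacements.\<close>
    obtain \<delta> where "0 < \<delta>" and \<delta>: "\<And>p q. \<lbrakk>p \<in> ?G \<times> S; q \<in> ?G \<times> S; dist q p < \<delta>\<rbrakk> \<Longrightarrow> dist (W q) (W p) < \<epsilon>/4"
      using unif_W[unfolded uniformly_continuous_on_def, rule_format, of "\<epsilon>/4"] \<open>0 < \<epsilon>\<close> by auto
    have near: "mdist D (A *v x) x \<le> \<epsilon>/4" if "A \<in> ?G" "dist A (mat 1) < \<delta>" "x \<in> S" for A x
    proof -
      have "dist (W (A, x)) (W (mat 1, x)) < \<epsilon>/4"
        using that rotation.unit_closed by (intro \<delta>) (auto simp: dist_Pair_Pair)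
      moreover have "W (mat 1, x) = 0"
        using that(3) D(1) Metric_space.mdist_zero[OF Metric_space_mspace_mdist, of x D] by (simp add: W_def)
      ultimately show ?thesis
        by (simp add: W_def dist_real_def)
    qed
    obtain p where p: "real_polynomial_function p" "\<And>g. g \<in> ?G \<Longrightarrow> 0 \<le> p g" "0 < ?m p"
      and conc: "\<And>w. \<lbrakk>continuous_on ?G w; \<And>g. g \<in> ?G \<Longrightarrow> w g \<le> 2 * B; \<And>g. \<lbrakk>g \<in> ?G; dist g (mat 1) < \<delta>\<rbrakk> \<Longrightarrow> w g \<le> \<epsilon>/2\<rbrakk>
          \<Longrightarrow> ?m (\<lambda>g. p g * w g) / ?m p \<le> 2 * (\<epsilon>/2)"
      by (rule concentrated_polynomial[OF rotation.compact_group_axioms \<open>0 < \<delta>\<close>, of "\<epsilon>/2" "2 * B"])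
        (use \<open>0 < \<epsilon>\<close> in auto)
    have cont_p: "continuous_on UNIV p"
      using p(1) by (simp add: continuous_on_polymonial_function flip: real_polynomial_function_eq)
    define \<Lambda> where "\<Lambda> u = ?m (\<lambda>g. p g * u g) / ?m p" for u
    interpret averaged_action D z ?G \<Lambda> "(*v)"
    proof (intro averaged_action.intro averaged_action_axioms.intro)
      show "mean_functional ?G \<Lambda>"
        unfolding \<Lambda>_def using p(2,3) continuous_on_subset[OF cont_p] by (intro rotation.weighted) auto
    qed (use pointed_metric_axioms compact_rotations rot_S D cont_orbit in auto)
    have approx: "\<bar>average f x - f x\<bar> \<le> \<epsilon> * lip_norm D f" if "f \<in> L" "x \<in> S" for f x
    proof (rule average_approx)
      have "\<Lambda> (\<lambda>A. mdist D (A *v x) x + mdist D (A *v z) z) \<le> 2 * (\<epsilon>/2)"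
        unfolding \<Lambda>_def
      proof (rule conc)
        show "continuous_on ?G (\<lambda>A. mdist D (A *v x) x + mdist D (A *v z) z)"
          using that D(4) by (intro continuous_on_add cont_orbit)
        show "mdist D (A *v x) x + mdist D (A *v z) z \<le> 2 * B" if "A \<in> ?G" for A
          using B[OF that \<open>x \<in> S\<close>] B[OF that D(4)] by linarith
        show "mdist D (A *v x) x + mdist D (A *v z) z \<le> \<epsilon>/2" if "A \<in> ?G" "dist A (mat 1) < \<delta>" for A
          using near[OF that \<open>x \<in> S\<close>] near[OF that D(4)] by linarith
      qed
      then show "\<Lambda> (\<lambda>A. mdist D (A *v x) x + mdist D (A *v z) z) \<le> \<epsilon>"
        by simp
    qed (use that D in auto)
    obtain n :: nat and a b where ab: "\<forall>i<n. continuous_on UNIV (a i)" "\<forall>A B :: real^'n^'n. p (A ** B) = (\<Sum>i<n. a i A * b i B)"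
      using real_polynomial_function_matrix_mult[OF p(1)] by (elim exE conjE)
    have a: "continuous_on T (a i)" if "i < n" for i T
      using ab(1) that continuous_on_subset by blast
    have "\<exists>A. rotation_matrix A \<and> A *v z = x" if "x \<in> S" for x
      by (rule rotation_transitive[OF assms(1,5), of x]) (use that in \<open>auto simp: S_def\<close>)
    \<comment> \<open>A pointwise choice, with no regularity in \<open>x\<close>. It replaces a
      point of the sphere by a group element.\<close>
    then obtain h where h: "\<And>x. x \<in> S \<Longrightarrow> rotation_matrix (h x)" "\<And>x. x \<in> S \<Longrightarrow> h x *v z = x"
      by metis
    \<comment> \<open>The subtracted term reflects the normalization of the average at
      \<open>z\<close>; \<open>h z\<close> fixes \<open>z\<close> but need not be the
      identity.\<close>
    define \<beta> where "\<beta> i x = (if x \<in> S then b i (transpose (h x)) - b i (transpose (h z)) else 0)" for i x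
    define c where "c f i = ?m (\<lambda>g. a i g * f (g *v z)) / ?m p" for f i
    have mean_orbit: "\<Lambda> (\<lambda>g. f (g *v x)) = (\<Sum>i<n. c f i * b i (transpose (h x)))"
      if f: "f \<in> L" and x: "x \<in> S" for f x
    proof -
      let ?h = "h x"
      \<comment> \<open>Right translation by \<open>?h\<close> cancels \<open>transpose ?h\<close>
        in the weight and turns \<open>z\<close> into \<open>x\<close> in the argument of
        \<open>f\<close>. By invariance \<open>x\<close> thus enters only through the weight, where
        it separates from \<open>g\<close>.\<close>
      define u where "u g = p (g ** transpose ?h) * f (g *v z)" for g
      have hG: "?h \<in> ?G" "transpose ?h \<in> ?G"
        using h(1)[OF x] rotation.iv_closed by auto
      have cont_f: "continuous_on ?G (\<lambda>g. f (g *v z))"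
        using continuous_orbit[OF f base_point] .
      have u: "continuous_on ?G u"
        unfolding u_def using cont_f rotation.continuous_translate[OF continuous_on_subset[OF cont_p] hG(2)]
        by (intro continuous_on_mult) auto
      have "u (g ** ?h) = p g * f (g *v x)" for g
        using h[OF x] by (simp add: u_def rotation_matrix_def orthogonal_matrix_def
            flip: matrix_mul_assoc matrix_vector_mul_assoc)
      then have "?m (\<lambda>g. p g * f (g *v x)) = ?m u"
        using rotation.mean_translate[OF u hG(1)] by simp
      also have "u = (\<lambda>g. \<Sum>i<n. b i (transpose ?h) * (a i g * f (g *v z)))"
        by (simp add: fun_eq_iff u_def ab(2) sum_distrib_left mult_ac)
      also have "?m \<dots> = (\<Sum>i<n. ?m (\<lambda>g. b i (transpose ?h) * (a i g * f (g *v z))))"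
        using a cont_f
        by (intro rotation.sum continuous_on_mult continuous_on_const) auto
      also have "\<dots> = (\<Sum>i<n. b i (transpose ?h) * ?m (\<lambda>g. a i g * f (g *v z)))"
        using a cont_f
        by (intro sum.cong refl rotation.scale continuous_on_mult) auto
      finally show ?thesis
        by (simp add: \<Lambda>_def c_def sum_divide_distrib mult.commute)
    qed
    have "average f = (\<Sum>i<n. c f i *\<^sub>R \<beta> i)" if f: "f \<in> L" for f
    proof
      fix x
      show "average f x = (\<Sum>i<n. c f i *\<^sub>R \<beta> i) x"
      proof (cases "x \<in> S")
        case True
        then have "average f x = \<Lambda> (\<lambda>g. f (g *v x)) - \<Lambda> (\<lambda>g. f (g *v z))"
          using D f base_point by (simp add: average_def diff continuous_orbit)
        also have "\<dots> = (\<Sum>i<n. c f i * \<beta> i x)"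
          using True D(4) f by (simp add: mean_orbit \<beta>_def right_diff_distrib sum_subtractf)
        finally show ?thesis
          by (simp add: sum_fun_apply)
      next
        case False
        then show ?thesis
          using D(1) by (simp add: average_def \<beta>_def sum_fun_apply)
      qed
    qed
    then have "average ` L \<subseteq> span (\<beta> ` {..<n})"
      by (auto intro!: span_sum span_scale intro: span_base)
    then show "\<exists>T C. linear_contraction L (lip_norm D) T \<and> finite C \<and> T ` L \<subseteq> span C \<and>
      (\<forall>x\<in>mspace D. linear_contraction.adjoint_map L T (evaluation D z x) \<in> F) \<and>
      (\<forall>x\<in>mspace D. \<forall>f\<in>L. \<bar>T f x - f x\<bar> \<le> \<epsilon> * lip_norm D f)"
      using average.linear_contraction_axioms adjoint_average_in_free_space approx D(1)
      by (intro exI[of _ average] exI[of _ "\<beta> ` {..<n}"]) auto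
  qed
qed

end
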